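(* Let $\mathcal{C}$ be a small category satisfying the following conditions: (C1) the canonical functor $\mathcal{C}^{\mathrm{op}}\to\mathrm{Sh}(\mathcal{C}^{\mathrm{op}},J_{\mathrm{at}})$ is fully faithful and sends each object of $\mathcal{C}^{\mathrm{op}}$ to an atom; (C2) $\mathcal{C}^{\mathrm{op}}$ has pushouts and $\mathcal{C}^{\mathrm{op}}\to\mathrm{Sh}(\mathcal{C}^{\mathrm{op}},J_{\mathrm{at}})$ preserves them; (C3) $\mathcal{C}$ is well-founded. Then the following are equivalent: 1. Every morphism in $\mathcal{C}$ is definable by self-intersections. 2. For every representable atom $n$ of $\mathrm{Sh}(\mathcal{C}^{\mathrm{op}},J_{\mathrm{at}})$ and every subgroup $G\subseteq\mathrm{Aut}(n)$, the quotient $n/G$ computed in the functor category $[\mathcal{C},\mathrm{Set}]$ is a sheaf. 3. The sheaves for the atomic topology are exactly the pullback-preserving functors $\mathcal{C}\to\mathrm{Set}$.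
   Context: The atomic topology $J_{\mathrm{at}}$ on $\mathcal{C}^{\mathrm{op}}$ is the Grothendieck topology generated by declaring all non-empty sieves covering; when every span in $\mathcal{C}$ admits a cocone (which is implied by (C1)), the covering sieves are exactly the non-empty sieves. Sheaves on $\mathcal{C}^{\mathrm{op}}$ are functors $\mathcal{C}\to\mathrm{Set}$. The canonical functor $\mathcal{C}^{\mathrm{op}}\to \mathrm{Sh}(\mathcal{C}^{\mathrm{op}},J_{\mathrm{at}})$ is the Yoneda embedding $n\mapsto\mathrm{Hom}_{\mathcal{C}}(n,-)$ followed by sheafification. An atom of a topos is a non-initial object whose only sub-objects are the initial object and itself. The representable atoms are those in the image of $\mathcal{C}^{\mathrm{op}}\to \mathrm{Sh}(\mathcal{C}^{\mathrm{op}},J_{\mathrm{at}})$. A category is co-well-founded if every diagram $x_0\to x_1\to x_2\to\cdots$ in it stabilizes, i.e. there is $i$ such that $x_i\to x_j$ is an isomorphism for all $j>i$. A category $\mathcal{C}$ is well-founded if $\mathcal{C}^{\mathrm{op}}$ is co-well-founded. A morphism $f:A\to B$ in $\mathcal{C}$ is definable by self-intersections if every arrow $u:Y\to B$ satisfying the following condition factors through $f$: for all $\alpha,\beta:B\rightrightarrows X$ with $\alpha\circ f=\beta\circ f$, there is $v:Y\to B$ such that $\beta\circ u=\alpha\circ v$. For a subgroup $G\subseteq\mathrm{Aut}(n)$, the quotient $n/G$ is the common coequalizer of all the arrows in $G$; in item 2 it is computed in $[\mathcal{C},\mathrm{Set}]$, i.e. pointwise. *)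

theory Defs
  imports Main "HOL-Library.FuncSet" "HOL-Algebra.Group"
begin

section \<open>Categories and functors\<close>

record ('o, 'a) cat =
  obj :: "'o set"
  arr :: "'a set"
  src :: "'a \<Rightarrow> 'o"
  tgt :: "'a \<Rightarrow> 'o"
  ident :: "'o \<Rightarrow> 'a"
  cmp :: "'a \<Rightarrow> 'a \<Rightarrow> 'a" (infixr \<open>\<cdot>\<index>\<close> 70)

definition homset :: "('o, 'a) cat \<Rightarrow> 'o \<Rightarrow> 'o \<Rightarrow> 'a set" where
  "homset C x y = {f \<in> arr C. src C f = x \<and> tgt C f = y}"

locale category =
  fixes C :: "('o, 'a) cat" (structure)
  assumes src_obj: "f \<in> arr C \<Longrightarrow> src C f \<in> obj C"
    and tgt_obj: "f \<in> arr C \<Longrightarrow> tgt C f \<in> obj C"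
    and ident_hom: "x \<in> obj C \<Longrightarrow> ident C x \<in> homset C x x"
    and cmp_hom: "\<lbrakk>f \<in> homset C x y; g \<in> homset C y z\<rbrakk> \<Longrightarrow> g \<cdot> f \<in> homset C x z"
    and cmp_ident_right: "f \<in> homset C x y \<Longrightarrow> f \<cdot> ident C x = f"
    and cmp_ident_left: "f \<in> homset C x y \<Longrightarrow> ident C y \<cdot> f = f"
    and cmp_assoc: "\<lbrakk>f \<in> homset C w x; g \<in> homset C x y; h \<in> homset C y z\<rbrakk>
      \<Longrightarrow> (h \<cdot> g) \<cdot> f = h \<cdot> (g \<cdot> f)"

definition opcat :: "('o, 'a) cat \<Rightarrow> ('o, 'a) cat" where
  "opcat C = \<lparr>obj = obj C, arr = arr C, src = tgt C, tgt = src C, ident = ident C,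
     cmp = (\<lambda>g f. f \<cdot>\<^bsub>C\<^esub> g)\<rparr>"

lemma opcat_opcat [simp]: "opcat (opcat C) = C"
  by (simp add: opcat_def)

definition full_subcat :: "('o, 'a) cat \<Rightarrow> 'o set \<Rightarrow> ('o, 'a) cat" where
  "full_subcat C X = C\<lparr>obj := obj C \<inter> X, arr := {f \<in> arr C. src C f \<in> X \<and> tgt C f \<in> X}\<rparr>"

record ('o1, 'a1, 'o2, 'a2) ftor =
  fob :: "'o1 \<Rightarrow> 'o2"
  far :: "'a1 \<Rightarrow> 'a2"

text \<open>Functors are extensional outside the source category, so that equality of functors
  (which are the objects of functor categories) is the mathematical one.\<close>

definition is_functor ::
  "('o1, 'a1) cat \<Rightarrow> ('o2, 'a2) cat \<Rightarrow> ('o1, 'a1, 'o2, 'a2) ftor \<Rightarrow> bool" where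
  "is_functor C D F \<longleftrightarrow>
     fob F \<in> obj C \<rightarrow>\<^sub>E obj D \<and>
     far F \<in> extensional (arr C) \<and>
     (\<forall>f\<in>arr C. far F f \<in> homset D (fob F (src C f)) (fob F (tgt C f))) \<and>
     (\<forall>x\<in>obj C. far F (ident C x) = ident D (fob F x)) \<and>
     (\<forall>f\<in>arr C. \<forall>g\<in>arr C. src C g = tgt C f \<longrightarrow>
        far F (g \<cdot>\<^bsub>C\<^esub> f) = far F g \<cdot>\<^bsub>D\<^esub> far F f)"

definition fcompose :: "('o1, 'a1) cat \<Rightarrow> ('o2, 'a2, 'o3, 'a3) ftor \<Rightarrow>
    ('o1, 'a1, 'o2, 'a2) ftor \<Rightarrow> ('o1, 'a1, 'o3, 'a3) ftor" where
  "fcompose C G F = \<lparr>fob = compose (obj C) (fob G) (fob F), far = compose (arr C) (far G) (far F)\<rparr>"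

definition fully_faithful ::
  "('o1, 'a1) cat \<Rightarrow> ('o2, 'a2) cat \<Rightarrow> ('o1, 'a1, 'o2, 'a2) ftor \<Rightarrow> bool" where
  "fully_faithful C D F \<longleftrightarrow>
     (\<forall>x\<in>obj C. \<forall>y\<in>obj C. bij_betw (far F) (homset C x y) (homset D (fob F x) (fob F y)))"


section \<open>Functor categories and the category of sets\<close>

text \<open>Arrows that carry their source and target: triples (source, target, underlying map).\<close>

type_synonym ('x, 'm) tarr = "'x \<times> 'x \<times> 'm"

abbreviation tsrc :: "('x, 'm) tarr \<Rightarrow> 'x" where "tsrc f \<equiv> fst f"
abbreviation ttgt :: "('x, 'm) tarr \<Rightarrow> 'x" where "ttgt f \<equiv> fst (snd f)"
abbreviation tmap :: "('x, 'm) tarr \<Rightarrow> 'm" where "tmap f \<equiv> snd (snd f)"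

definition functor_cat :: "('o1, 'a1) cat \<Rightarrow> ('o2, 'a2) cat \<Rightarrow>
    (('o1, 'a1, 'o2, 'a2) ftor, (('o1, 'a1, 'o2, 'a2) ftor, 'o1 \<Rightarrow> 'a2) tarr) cat" where
  "functor_cat C D = \<lparr>
     obj = {F. is_functor C D F},
     arr = {(F, G, \<eta>). is_functor C D F \<and> is_functor C D G \<and> \<eta> \<in> extensional (obj C) \<and>
        (\<forall>x\<in>obj C. \<eta> x \<in> homset D (fob F x) (fob G x)) \<and>
        (\<forall>f\<in>arr C. \<eta> (tgt C f) \<cdot>\<^bsub>D\<^esub> far F f = far G f \<cdot>\<^bsub>D\<^esub> \<eta> (src C f))},
     src = tsrc,
     tgt = ttgt,
     ident = (\<lambda>F. (F, F, \<lambda>x\<in>obj C. ident D (fob F x))),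
     cmp = (\<lambda>\<theta> \<eta>. (tsrc \<eta>, ttgt \<theta>, \<lambda>x\<in>obj C. tmap \<theta> x \<cdot>\<^bsub>D\<^esub> tmap \<eta> x))\<rparr>"

text \<open>The type \<open>'s\<close> plays the role of the universe: Set is the category of all sets of elements
  of \<open>'s\<close> and all functions between them.  A category is small relative to this universe when its
  arrows can be embedded into \<open>'s\<close>.  For infinite such \<open>'s\<close>, set-valued functors in this sense
  are closed under sub-objects, quotients, sums indexed by objects or arrows, and sheafification for
  the atomic topology (when its covering sieves are the non-empty ones); \<open>'s\<close> itself can be
  taken arbitrarily large.\<close>

type_synonym 's setarr = "('s set, 's \<Rightarrow> 's) tarr"

definition set_cat :: "('s set, 's setarr) cat" where
  "set_cat = \<lparr>
     obj = UNIV,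
     arr = {(A, B, f). f \<in> A \<rightarrow>\<^sub>E B},
     src = tsrc,
     tgt = ttgt,
     ident = (\<lambda>A. (A, A, \<lambda>x\<in>A. x)),
     cmp = (\<lambda>g f. (tsrc f, ttgt g, compose (tsrc f) (tmap g) (tmap f)))\<rparr>"

type_synonym ('o, 'a, 's) setftor = "('o, 'a, 's set, 's setarr) ftor"
type_synonym ('o, 'a, 's) setnat = "(('o, 'a, 's) setftor, 'o \<Rightarrow> 's setarr) tarr"

abbreviation presheaf_cat ::
  "('o, 'a) cat \<Rightarrow> (('o, 'a, 's) setftor, ('o, 'a, 's) setnat) cat" where
  "presheaf_cat D \<equiv> functor_cat (opcat D) set_cat"

text \<open>The hom-sets consist of elements of \<open>'a\<close>; they are moved into the universe \<open>'s\<close> along a map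
  \<open>\<iota>\<close> that is injective on the arrows.\<close>

definition hom_presheaf :: "('o, 'a) cat \<Rightarrow> ('a \<Rightarrow> 's) \<Rightarrow> 'o \<Rightarrow> ('o, 'a, 's) setftor" where
  "hom_presheaf D \<iota> n = \<lparr>
     fob = (\<lambda>m\<in>obj D. \<iota> ` homset D m n),
     far = (\<lambda>f\<in>arr D. (\<iota> ` homset D (tgt D f) n, \<iota> ` homset D (src D f) n,
              \<lambda>e \<in> \<iota> ` homset D (tgt D f) n. \<iota> (inv_into (arr D) \<iota> e \<cdot>\<^bsub>D\<^esub> f)))\<rparr>"

definition yoneda :: "('o, 'a) cat \<Rightarrow> ('a \<Rightarrow> 's) \<Rightarrow>
    ('o, 'a, ('o, 'a, 's) setftor, ('o, 'a, 's) setnat) ftor" where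
  "yoneda D \<iota> = \<lparr>
     fob = (\<lambda>n\<in>obj D. hom_presheaf D \<iota> n),
     far = (\<lambda>g\<in>arr D. (hom_presheaf D \<iota> (src D g), hom_presheaf D \<iota> (tgt D g),
              \<lambda>m\<in>obj D. (\<iota> ` homset D m (src D g), \<iota> ` homset D m (tgt D g),
                 \<lambda>e \<in> \<iota> ` homset D m (src D g). \<iota> (g \<cdot>\<^bsub>D\<^esub> inv_into (arr D) \<iota> e))))\<rparr>"


section \<open>Notions in an arbitrary category\<close>

definition is_iso :: "('o, 'a) cat \<Rightarrow> 'a \<Rightarrow> bool" where
  "is_iso C f \<longleftrightarrow> f \<in> arr C \<and>
     (\<exists>g\<in>homset C (tgt C f) (src C f).
        g \<cdot>\<^bsub>C\<^esub> f = ident C (src C f) \<and> f \<cdot>\<^bsub>C\<^esub> g = ident C (tgt C f))"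

definition is_mono :: "('o, 'a) cat \<Rightarrow> 'a \<Rightarrow> bool" where
  "is_mono C f \<longleftrightarrow> f \<in> arr C \<and>
     (\<forall>w\<in>obj C. \<forall>g\<in>homset C w (src C f). \<forall>h\<in>homset C w (src C f).
        f \<cdot>\<^bsub>C\<^esub> g = f \<cdot>\<^bsub>C\<^esub> h \<longrightarrow> g = h)"

definition is_initial :: "('o, 'a) cat \<Rightarrow> 'o \<Rightarrow> bool" where
  "is_initial C x \<longleftrightarrow> x \<in> obj C \<and> (\<forall>y\<in>obj C. \<exists>!f. f \<in> homset C x y)"

text \<open>A sub-object of \<open>x\<close> is represented by a monomorphism into \<open>x\<close>; it is the initial
  sub-object when its source is initial, and \<open>x\<close> itself when the monomorphism is invertible.\<close>

definition is_atom :: "('o, 'a) cat \<Rightarrow> 'o \<Rightarrow> bool" where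
  "is_atom C x \<longleftrightarrow> x \<in> obj C \<and> \<not> is_initial C x \<and>
     (\<forall>m. is_mono C m \<and> tgt C m = x \<longrightarrow> is_initial C (src C m) \<or> is_iso C m)"

definition aut_group :: "('o, 'a) cat \<Rightarrow> 'o \<Rightarrow> 'a monoid" where
  "aut_group C x = \<lparr>carrier = {f \<in> homset C x x. is_iso C f}, mult = cmp C, one = ident C x\<rparr>"

definition is_common_coequalizer ::
  "('o, 'a) cat \<Rightarrow> 'o \<Rightarrow> 'a set \<Rightarrow> 'o \<Rightarrow> 'a \<Rightarrow> bool" where
  "is_common_coequalizer C n G Q q \<longleftrightarrow>
     q \<in> homset C n Q \<and>
     (\<forall>g\<in>G. \<forall>h\<in>G. q \<cdot>\<^bsub>C\<^esub> g = q \<cdot>\<^bsub>C\<^esub> h) \<and>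
     (\<forall>Z\<in>obj C. \<forall>z\<in>homset C n Z. (\<forall>g\<in>G. \<forall>h\<in>G. z \<cdot>\<^bsub>C\<^esub> g = z \<cdot>\<^bsub>C\<^esub> h) \<longrightarrow>
        (\<exists>!k. k \<in> homset C Q Z \<and> k \<cdot>\<^bsub>C\<^esub> q = z))"

text \<open>\<open>f\<close>, \<open>g\<close> form the cospan; \<open>p\<close>, \<open>q\<close> are the projections, with \<open>f \<cdot> p = g \<cdot> q\<close>.\<close>

definition is_pullback :: "('o, 'a) cat \<Rightarrow> 'a \<Rightarrow> 'a \<Rightarrow> 'a \<Rightarrow> 'a \<Rightarrow> bool" where
  "is_pullback C f g p q \<longleftrightarrow>
     f \<in> arr C \<and> g \<in> arr C \<and> tgt C f = tgt C g \<and>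
     p \<in> arr C \<and> q \<in> arr C \<and> src C p = src C q \<and>
     tgt C p = src C f \<and> tgt C q = src C g \<and> f \<cdot>\<^bsub>C\<^esub> p = g \<cdot>\<^bsub>C\<^esub> q \<and>
     (\<forall>w\<in>obj C. \<forall>a\<in>homset C w (src C f). \<forall>b\<in>homset C w (src C g).
        f \<cdot>\<^bsub>C\<^esub> a = g \<cdot>\<^bsub>C\<^esub> b \<longrightarrow>
        (\<exists>!k. k \<in> homset C w (src C p) \<and> p \<cdot>\<^bsub>C\<^esub> k = a \<and> q \<cdot>\<^bsub>C\<^esub> k = b))"

definition is_pushout :: "('o, 'a) cat \<Rightarrow> 'a \<Rightarrow> 'a \<Rightarrow> 'a \<Rightarrow> 'a \<Rightarrow> bool" where
  "is_pushout C f g i j \<longleftrightarrow> is_pullback (opcat C) f g i j"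

definition has_pushouts :: "('o, 'a) cat \<Rightarrow> bool" where
  "has_pushouts C \<longleftrightarrow>
     (\<forall>f\<in>arr C. \<forall>g\<in>arr C. src C f = src C g \<longrightarrow> (\<exists>i j. is_pushout C f g i j))"

definition preserves_pushouts ::
  "('o1, 'a1) cat \<Rightarrow> ('o2, 'a2) cat \<Rightarrow> ('o1, 'a1, 'o2, 'a2) ftor \<Rightarrow> bool" where
  "preserves_pushouts C D F \<longleftrightarrow>
     (\<forall>f g i j. is_pushout C f g i j \<longrightarrow> is_pushout D (far F f) (far F g) (far F i) (far F j))"

definition preserves_pullbacks ::
  "('o1, 'a1) cat \<Rightarrow> ('o2, 'a2) cat \<Rightarrow> ('o1, 'a1, 'o2, 'a2) ftor \<Rightarrow> bool" where
  "preserves_pullbacks C D F \<longleftrightarrow>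
     (\<forall>f g p q. is_pullback C f g p q \<longrightarrow> is_pullback D (far F f) (far F g) (far F p) (far F q))"

text \<open>\<open>chain_map C x f i k\<close> is the composite \<open>x i \<rightarrow> x (i + k)\<close> of the arrows \<open>f j : x j \<rightarrow> x (j + 1)\<close>.\<close>

primrec chain_map ::
  "('o, 'a) cat \<Rightarrow> (nat \<Rightarrow> 'o) \<Rightarrow> (nat \<Rightarrow> 'a) \<Rightarrow> nat \<Rightarrow> nat \<Rightarrow> 'a" where
  "chain_map C x f i 0 = ident C (x i)"
| "chain_map C x f i (Suc k) = f (i + k) \<cdot>\<^bsub>C\<^esub> chain_map C x f i k"

definition co_well_founded :: "('o, 'a) cat \<Rightarrow> bool" where
  "co_well_founded C \<longleftrightarrow>
     (\<forall>x f. (\<forall>i. x i \<in> obj C) \<and> (\<forall>i. f i \<in> homset C (x i) (x (Suc i))) \<longrightarrow>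
        (\<exists>i. \<forall>j>i. is_iso C (chain_map C x f i (j - i))))"

definition well_founded :: "('o, 'a) cat \<Rightarrow> bool" where
  "well_founded C \<longleftrightarrow> co_well_founded (opcat C)"

definition definable_by_self_intersections :: "('o, 'a) cat \<Rightarrow> 'a \<Rightarrow> bool" where
  "definable_by_self_intersections C f \<longleftrightarrow>
     (\<forall>u\<in>arr C. tgt C u = tgt C f \<longrightarrow>
        (\<forall>X\<in>obj C. \<forall>\<alpha>\<in>homset C (tgt C f) X. \<forall>\<beta>\<in>homset C (tgt C f) X.
           \<alpha> \<cdot>\<^bsub>C\<^esub> f = \<beta> \<cdot>\<^bsub>C\<^esub> f \<longrightarrow>
           (\<exists>v\<in>homset C (src C u) (tgt C f). \<beta> \<cdot>\<^bsub>C\<^esub> u = \<alpha> \<cdot>\<^bsub>C\<^esub> v)) \<longrightarrow>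
        (\<exists>w\<in>homset C (src C u) (src C f). u = f \<cdot>\<^bsub>C\<^esub> w))"


section \<open>Grothendieck topologies and sheaves\<close>

definition sieve :: "('o, 'a) cat \<Rightarrow> 'o \<Rightarrow> 'a set \<Rightarrow> bool" where
  "sieve D c S \<longleftrightarrow> S \<subseteq> {f \<in> arr D. tgt D f = c} \<and>
     (\<forall>f\<in>S. \<forall>g\<in>arr D. tgt D g = src D f \<longrightarrow> f \<cdot>\<^bsub>D\<^esub> g \<in> S)"

definition pullback_sieve :: "('o, 'a) cat \<Rightarrow> 'a \<Rightarrow> 'a set \<Rightarrow> 'a set" where
  "pullback_sieve D f S = {g \<in> arr D. tgt D g = src D f \<and> f \<cdot>\<^bsub>D\<^esub> g \<in> S}"

definition grothendieck_topology :: "('o, 'a) cat \<Rightarrow> ('o \<Rightarrow> 'a set set) \<Rightarrow> bool" where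
  "grothendieck_topology D J \<longleftrightarrow>
     (\<forall>c\<in>obj D. \<forall>S\<in>J c. sieve D c S) \<and>
     (\<forall>c\<in>obj D. {f \<in> arr D. tgt D f = c} \<in> J c) \<and>
     (\<forall>c\<in>obj D. \<forall>S\<in>J c. \<forall>f\<in>arr D. tgt D f = c \<longrightarrow> pullback_sieve D f S \<in> J (src D f)) \<and>
     (\<forall>c\<in>obj D. \<forall>S\<in>J c. \<forall>R. sieve D c R \<and> (\<forall>f\<in>S. pullback_sieve D f R \<in> J (src D f))
        \<longrightarrow> R \<in> J c)"

definition generated_topology ::
  "('o, 'a) cat \<Rightarrow> ('o \<Rightarrow> 'a set set) \<Rightarrow> 'o \<Rightarrow> 'a set set" where
  "generated_topology D K c =
     \<Inter> {J c | J. grothendieck_topology D J \<and> (\<forall>d\<in>obj D. K d \<subseteq> J d)}"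

definition atomic_topology :: "('o, 'a) cat \<Rightarrow> 'o \<Rightarrow> 'a set set" where
  "atomic_topology D = generated_topology D (\<lambda>c. {S. sieve D c S \<and> S \<noteq> {}})"

definition is_sheaf ::
  "('o, 'a) cat \<Rightarrow> ('o \<Rightarrow> 'a set set) \<Rightarrow> ('o, 'a, 's) setftor \<Rightarrow> bool" where
  "is_sheaf D J F \<longleftrightarrow> is_functor (opcat D) set_cat F \<and>
     (\<forall>c\<in>obj D. \<forall>S\<in>J c. \<forall>x.
        (\<forall>f\<in>S. x f \<in> fob F (src D f)) \<and>
        (\<forall>f\<in>S. \<forall>g\<in>arr D. tgt D g = src D f \<longrightarrow> tmap (far F g) (x f) = x (f \<cdot>\<^bsub>D\<^esub> g)) \<longrightarrow>
        (\<exists>!y. y \<in> fob F c \<and> (\<forall>f\<in>S. tmap (far F f) y = x f)))"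

definition sheaf_cat :: "('o, 'a) cat \<Rightarrow> ('o \<Rightarrow> 'a set set) \<Rightarrow>
    (('o, 'a, 's) setftor, ('o, 'a, 's) setnat) cat" where
  "sheaf_cat D J = full_subcat (presheaf_cat D) {F. is_sheaf D J F}"

text \<open>Sheafification is the left adjoint \<open>L\<close> of the inclusion of sheaves into presheaves, with
  unit \<open>\<eta>\<close>.  It is determined up to unique isomorphism only, hence a predicate.\<close>

definition is_sheafification :: "('o, 'a) cat \<Rightarrow> ('o \<Rightarrow> 'a set set) \<Rightarrow>
    (('o, 'a, 's) setftor, ('o, 'a, 's) setnat, ('o, 'a, 's) setftor, ('o, 'a, 's) setnat) ftor \<Rightarrow>
    (('o, 'a, 's) setftor \<Rightarrow> ('o, 'a, 's) setnat) \<Rightarrow> bool" where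
  "is_sheafification D J L \<eta> \<longleftrightarrow>
     is_functor (presheaf_cat D) (sheaf_cat D J) L \<and>
     (\<forall>P\<in>obj (presheaf_cat D). \<eta> P \<in> homset (presheaf_cat D) P (fob L P)) \<and>
     (\<forall>t\<in>arr (presheaf_cat D).
        \<eta> (ttgt t) \<cdot>\<^bsub>presheaf_cat D\<^esub> t = far L t \<cdot>\<^bsub>presheaf_cat D\<^esub> \<eta> (tsrc t)) \<and>
     (\<forall>P\<in>obj (presheaf_cat D). \<forall>F\<in>obj (sheaf_cat D J). \<forall>h\<in>homset (presheaf_cat D) P F.
        \<exists>!k. k \<in> homset (sheaf_cat D J) (fob L P) F \<and> k \<cdot>\<^bsub>presheaf_cat D\<^esub> \<eta> P = h)"

definition canonical_functor :: "('o, 'a) cat \<Rightarrow> ('a \<Rightarrow> 's) \<Rightarrow>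
    (('o, 'a, 's) setftor, ('o, 'a, 's) setnat, ('o, 'a, 's) setftor, ('o, 'a, 's) setnat) ftor \<Rightarrow>
    ('o, 'a, ('o, 'a, 's) setftor, ('o, 'a, 's) setnat) ftor" where
  "canonical_functor D \<iota> L = fcompose D L (yoneda D \<iota>)"

abbreviation atomic_sheaf_cat ::
  "('o, 'a) cat \<Rightarrow> (('o, 'a, 's) setftor, ('o, 'a, 's) setnat) cat" where
  "atomic_sheaf_cat D \<equiv> sheaf_cat D (atomic_topology D)"

definition is_representable_atom :: "('o, 'a) cat \<Rightarrow> ('a \<Rightarrow> 's) \<Rightarrow>
    (('o, 'a, 's) setftor, ('o, 'a, 's) setnat, ('o, 'a, 's) setftor, ('o, 'a, 's) setnat) ftor \<Rightarrow>
    ('o, 'a, 's) setftor \<Rightarrow> bool" where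
  "is_representable_atom D \<iota> L n \<longleftrightarrow>
     is_atom (atomic_sheaf_cat D) n \<and> n \<in> fob (canonical_functor D \<iota> L) ` obj D"

end

theory Submission imports Defs begin

text \<open>
  If some span had no cocone, the empty sieve would cover an object and its representable sheaf would
  be initial; so (C1) forces all non-empty sieves, and no others, to cover.  Full faithfulness then
  makes the hom-functors sheaves, whence every arrow of \<open>C\<close> is mono, and since sections of a sheaf
  at \<open>c\<close> are maps out of the representable sheaf of \<open>c\<close>, (C2) says that every sheaf preserves pullbacks.

  (1) implies (3): by well-foundedness an element \<open>e\<close> at \<open>B\<close> of a pullback-preserving functor has a
  least support \<open>m : I \<rightarrow> B\<close>, and postcomposing with any arrow again gives the least support of the
  image of \<open>e\<close>.  If \<open>e\<close> is matching for \<open>f\<close>, then \<open>m\<close> therefore satisfies the self-intersection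
  condition, so it factors through \<open>f\<close> and \<open>e\<close> descends along \<open>f\<close>.

  (3) implies (2): a group of automorphisms of a representable sheaf acts freely, so the
  pointwise quotient still preserves pullbacks.

  (2) implies (1): by well-foundedness the arrows satisfying the self-intersection condition for \<open>f\<close>
  have a largest element \<open>i : I \<rightarrow> B\<close>.  If \<open>\<alpha> f = \<beta> f\<close>, then \<open>\<beta> i = \<alpha> i s\<close> with \<open>s\<close> an automorphism of
  \<open>I\<close>, so the class of \<open>i\<close> in the quotient of the representable sheaf of \<open>I\<close> by its full
  automorphism group is matching for \<open>f\<close>.  It descends along \<open>f\<close>, which makes \<open>i\<close> factor through \<open>f\<close>.
\<close>

section \<open>Categories and their opposites\<close>

lemma opcat_sel [simp]:
  "obj (opcat C) = obj C" "arr (opcat C) = arr C" "src (opcat C) = tgt C" "tgt (opcat C) = src C"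
  "ident (opcat C) = ident C" "g \<cdot>\<^bsub>opcat C\<^esub> f = f \<cdot>\<^bsub>C\<^esub> g"
  by (auto simp: opcat_def)

lemma homset_opcat [simp]: "homset (opcat C) x y = homset C y x"
  by (auto simp: homset_def)

lemma homsetD:
  assumes "f \<in> homset C x y"
  shows "f \<in> arr C" "src C f = x" "tgt C f = y"
  using assms by (auto simp: homset_def)

lemma arr_homset: "f \<in> arr C \<Longrightarrow> f \<in> homset C (src C f) (tgt C f)"
  by (auto simp: homset_def)

lemma is_iso_opcat [simp]: "is_iso (opcat C) f \<longleftrightarrow> is_iso C f"
  by (auto simp: is_iso_def)

context category
begin

lemma homset_obj:
  assumes "f \<in> homset C x y"
  shows "x \<in> obj C" "y \<in> obj C"
  using assms src_obj tgt_obj by (auto simp: homset_def)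

lemma cmp_arr:
  assumes "f \<in> arr C" "g \<in> arr C" "src C g = tgt C f"
  shows "g \<cdot> f \<in> arr C" "src C (g \<cdot> f) = src C f" "tgt C (g \<cdot> f) = tgt C g"
proof -
  have "g \<cdot> f \<in> homset C (src C f) (tgt C g)"
    using assms by (intro cmp_hom) (auto simp: homset_def)
  then show "g \<cdot> f \<in> arr C" "src C (g \<cdot> f) = src C f" "tgt C (g \<cdot> f) = tgt C g"
    by (auto simp: homset_def)
qed

lemma ident_arr:
  assumes "x \<in> obj C"
  shows "ident C x \<in> arr C" "src C (ident C x) = x" "tgt C (ident C x) = x"
  using ident_hom[OF assms] by (auto simp: homset_def)

lemma assoc_arr:
  assumes "f \<in> arr C" "g \<in> arr C" "h \<in> arr C" "src C g = tgt C f" "src C h = tgt C g"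
  shows "(h \<cdot> g) \<cdot> f = h \<cdot> (g \<cdot> f)"
  using assms cmp_assoc[of f "src C f" "tgt C f" g "tgt C g" h "tgt C h"] by (auto simp: homset_def)

lemma ident_cmp_arr:
  assumes "f \<in> arr C"
  shows "src C f = x \<Longrightarrow> f \<cdot> ident C x = f" "tgt C f = y \<Longrightarrow> ident C y \<cdot> f = f"
  using assms cmp_ident_right[of f x "tgt C f"] cmp_ident_left[of f "src C f" y]
  by (auto simp: homset_def)

lemma is_isoE:
  assumes "is_iso C f" "f \<in> homset C x y"
  obtains g where "g \<in> homset C y x" "g \<cdot> f = ident C x" "f \<cdot> g = ident C y"
  using assms by (auto simp: is_iso_def homset_def)

lemma is_isoI:
  assumes "f \<in> homset C x y" "g \<in> homset C y x" "g \<cdot> f = ident C x" "f \<cdot> g = ident C y"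
  shows "is_iso C f"
  using assms by (auto simp: is_iso_def homset_def)

lemma group_aut_group:
  assumes x: "x \<in> obj C"
  shows "group (aut_group C x)"
proof (rule groupI)
  fix f g assume "f \<in> carrier (aut_group C x)" "g \<in> carrier (aut_group C x)"
  then have f: "f \<in> homset C x x" "is_iso C f" and g: "g \<in> homset C x x" "is_iso C g"
    by (auto simp: aut_group_def)
  obtain f' where f': "f' \<in> homset C x x" "f' \<cdot> f = ident C x" "f \<cdot> f' = ident C x"
    using f is_isoE by blast
  obtain g' where g': "g' \<in> homset C x x" "g' \<cdot> g = ident C x" "g \<cdot> g' = ident C x"
    using g is_isoE by blast
  have "(g' \<cdot> f') \<cdot> (f \<cdot> g) = g' \<cdot> ((f' \<cdot> f) \<cdot> g)"
    using f(1) g(1) f'(1) g'(1) by (simp add: homset_def assoc_arr cmp_arr)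
  moreover have "(f \<cdot> g) \<cdot> (g' \<cdot> f') = f \<cdot> ((g \<cdot> g') \<cdot> f')"
    using f(1) g(1) f'(1) g'(1) by (simp add: homset_def assoc_arr cmp_arr)
  ultimately have "is_iso C (f \<cdot> g)"
    using f(1) g(1) f' g' is_isoI[of "f \<cdot> g" x x "g' \<cdot> f'"] cmp_hom[of _ x x _ x]
    by (simp add: cmp_ident_left)
  then show "f \<otimes>\<^bsub>aut_group C x\<^esub> g \<in> carrier (aut_group C x)"
    using cmp_hom[OF g(1) f(1)] by (simp add: aut_group_def)
next
  show "\<one>\<^bsub>aut_group C x\<^esub> \<in> carrier (aut_group C x)"
    using x ident_hom[OF x] is_isoI[of "ident C x" x x "ident C x"]
    by (simp add: aut_group_def cmp_ident_left[OF ident_hom[OF x]])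
next
  fix f assume "f \<in> carrier (aut_group C x)"
  then have f: "f \<in> homset C x x" "is_iso C f" by (auto simp: aut_group_def)
  obtain f' where f': "f' \<in> homset C x x" "f' \<cdot> f = ident C x" "f \<cdot> f' = ident C x"
    using f is_isoE by blast
  moreover have "is_iso C f'" using f' f(1) is_isoI by blast
  ultimately show "\<exists>y\<in>carrier (aut_group C x). y \<otimes>\<^bsub>aut_group C x\<^esub> f = \<one>\<^bsub>aut_group C x\<^esub>"
    by (auto simp: aut_group_def)
qed (auto simp: aut_group_def cmp_assoc cmp_ident_left)

end

section \<open>Consequences of well-foundedness\<close>

lemma chain_has_iso:
  assumes "category C" "well_founded C"
    and f: "\<And>i. f i \<in> homset C (x (Suc i)) (x i)"
  shows "\<exists>i. is_iso C (f i)"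
proof -
  interpret category C by fact
  have x: "(\<forall>i. x i \<in> obj (opcat C)) \<and> (\<forall>i. f i \<in> homset (opcat C) (x i) (x (Suc i)))"
    using f homset_obj(2)[OF f] by simp
  obtain i where "\<forall>j>i. is_iso (opcat C) (chain_map (opcat C) x f i (j - i))"
    using assms(2)[unfolded well_founded_def co_well_founded_def, rule_format, OF x] by (rule exE)
  \<comment> \<open>For \<open>j = i + 1\<close> the composite has length one: it is
    \<open>f i\<close> together with the identity that starts the recursion of
    \<open>chain_map\<close>.\<close>
  then have "is_iso (opcat C) (chain_map (opcat C) x f i (Suc i - i))" by (rule allE[of _ "Suc i"]) simp
  moreover have "chain_map (opcat C) x f i (Suc i - i) = f i"
    using cmp_ident_left[OF f[of i]] by (simp add: homset_def)
  ultimately show ?thesis by auto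
qed

text \<open>If every arrow satisfying \<open>\<Phi>\<close> could be shrunk by a non-invertible
  arrow, repeated shrinking would give an infinite descending chain without isomorphisms. Smaller
  means precomposed, so minimality says that only isomorphisms \<open>n\<close> keep
  \<open>\<Phi>\<close> true of the composite. This yields both least supports and largest
  self-intersecting arrows.\<close>

lemma exists_minimal_arrow:
  assumes "category C" "well_founded C"
    and m0: "m0 \<in> arr C" "\<Phi> m0"
  shows "\<exists>m. m \<in> arr C \<and> tgt C m = tgt C m0 \<and> \<Phi> m \<and>
    (\<forall>n\<in>arr C. tgt C n = src C m \<longrightarrow> \<Phi> (m \<cdot>\<^bsub>C\<^esub> n) \<longrightarrow> is_iso C n)"
proof (rule ccontr)
  interpret category C by fact
  define P where "P m \<longleftrightarrow> m \<in> arr C \<and> tgt C m = tgt C m0 \<and> \<Phi> m" for m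
  define N where
    "N m n \<longleftrightarrow> n \<in> arr C \<and> tgt C n = src C m \<and> \<Phi> (m \<cdot>\<^bsub>C\<^esub> n) \<and> \<not> is_iso C n" for m n
  assume "\<not> ?thesis"
  then have "\<forall>m. \<exists>n. P m \<longrightarrow> N m n" unfolding P_def N_def by blast
  from choice[OF this] obtain n where n: "\<forall>m. P m \<longrightarrow> N m (n m)" by (rule exE)
  \<comment> \<open>\<open>M\<close> shrinks \<open>m0\<close> over and over; the arrows
    \<open>n (M k)\<close> run from the source of \<open>M (Suc k)\<close> to the source of
    \<open>M k\<close> and so form the forbidden chain.\<close>
  define M where "M = rec_nat m0 (\<lambda>_ m. m \<cdot>\<^bsub>C\<^esub> n m)"
  have M: "M 0 = m0" "M (Suc k) = M k \<cdot>\<^bsub>C\<^esub> n (M k)" for k by (simp_all add: M_def)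
  have P: "P (M k)" for k
  proof (induction k)
    case 0
    show ?case by (simp add: M P_def m0)
  next
    case (Suc k)
    then have "N (M k) (n (M k))" using n by blast
    then show ?case using Suc cmp_arr[of "n (M k)" "M k"] by (simp add: M P_def N_def)
  qed
  have N: "N (M k) (n (M k))" for k using P n by blast
  have "n (M k) \<in> homset C (src C (M (Suc k))) (src C (M k))" for k
    using N[of k] P[of k] cmp_arr[of "n (M k)" "M k"] by (simp add: M P_def N_def homset_def)
  from chain_has_iso[where f = "\<lambda>k. n (M k)" and x = "\<lambda>k. src C (M k)", OF assms(1,2) this]
  obtain k where "is_iso C (n (M k))" by (rule exE)
  with N[of k] show False by (simp add: N_def)
qed


section \<open>Set-valued functors\<close>

abbreviation act :: "('o, 'a, 's) setftor \<Rightarrow> 'a \<Rightarrow> 's \<Rightarrow> 's" where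
  "act F f \<equiv> tmap (far F f)"

abbreviation app :: "('o, 'a, 's) setnat \<Rightarrow> 'o \<Rightarrow> 's \<Rightarrow> 's" where
  "app t x \<equiv> tmap (tmap t x)"

lemma set_cat_sel [simp]:
  "obj set_cat = UNIV" "src set_cat = tsrc" "tgt set_cat = ttgt"
  "ident set_cat A = (A, A, \<lambda>x\<in>A. x)"
  "g \<cdot>\<^bsub>set_cat\<^esub> f = (tsrc f, ttgt g, compose (tsrc f) (tmap g) (tmap f))"
  by (auto simp: set_cat_def)

lemma homset_set_cat: "f \<in> homset set_cat A B \<longleftrightarrow> tsrc f = A \<and> ttgt f = B \<and> tmap f \<in> A \<rightarrow>\<^sub>E B"
  by (cases f) (auto simp: homset_def set_cat_def)

lemma functor_far:
  assumes "is_functor C set_cat F" "f \<in> arr C"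
  shows "tsrc (far F f) = fob F (src C f)" "ttgt (far F f) = fob F (tgt C f)"
    "act F f \<in> fob F (src C f) \<rightarrow>\<^sub>E fob F (tgt C f)"
  using assms by (auto simp: is_functor_def homset_set_cat)

lemma act_mem:
  "\<lbrakk>is_functor C set_cat F; f \<in> homset C x y; e \<in> fob F x\<rbrakk> \<Longrightarrow> act F f e \<in> fob F y"
  using functor_far(3) by (fastforce simp: homset_def)

lemma act_ident:
  assumes "is_functor C set_cat F" "x \<in> obj C" "e \<in> fob F x"
  shows "act F (ident C x) e = e"
  using assms by (auto simp: is_functor_def)

lemma act_cmp:
  assumes "is_functor C set_cat F" "f \<in> homset C x y" "g \<in> homset C y z" "e \<in> fob F x"
  shows "act F (g \<cdot>\<^bsub>C\<^esub> f) e = act F g (act F f e)"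
proof -
  have "far F (g \<cdot>\<^bsub>C\<^esub> f) = far F g \<cdot>\<^bsub>set_cat\<^esub> far F f"
    using assms by (auto simp: is_functor_def homset_def)
  then show ?thesis using assms functor_far(1)[OF assms(1), of f]
    by (auto simp: compose_def homset_def)
qed

text \<open>The restrictions supply the extensionality required by \<open>is_functor\<close>, so
  that functoriality only has to be checked on elements of the sets \<open>A x\<close>.\<close>

definition set_ftor ::
  "('o, 'a) cat \<Rightarrow> ('o \<Rightarrow> 's set) \<Rightarrow> ('a \<Rightarrow> 's \<Rightarrow> 's) \<Rightarrow> ('o, 'a, 's) setftor" where
  "set_ftor C A \<phi> = \<lparr>fob = \<lambda>x\<in>obj C. A x,
     far = \<lambda>f\<in>arr C. (A (src C f), A (tgt C f), \<lambda>e\<in>A (src C f). \<phi> f e)\<rparr>"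

lemma fob_set_ftor [simp]: "x \<in> obj C \<Longrightarrow> fob (set_ftor C A \<phi>) x = A x"
  by (simp add: set_ftor_def)

lemma act_set_ftor [simp]:
  "f \<in> arr C \<Longrightarrow> e \<in> A (src C f) \<Longrightarrow> act (set_ftor C A \<phi>) f e = \<phi> f e"
  by (simp add: set_ftor_def)

lemma is_functor_set_ftor:
  assumes "category C"
    and mem: "\<And>f e. f \<in> arr C \<Longrightarrow> e \<in> A (src C f) \<Longrightarrow> \<phi> f e \<in> A (tgt C f)"
    and id: "\<And>x e. x \<in> obj C \<Longrightarrow> e \<in> A x \<Longrightarrow> \<phi> (ident C x) e = e"
    and comp: "\<And>f g e. f \<in> arr C \<Longrightarrow> g \<in> arr C \<Longrightarrow> src C g = tgt C f \<Longrightarrow> e \<in> A (src C f) \<Longrightarrow>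
      \<phi> (g \<cdot>\<^bsub>C\<^esub> f) e = \<phi> g (\<phi> f e)"
  shows "is_functor C set_cat (set_ftor C A \<phi>)"
proof -
  interpret category C by fact
  have "far (set_ftor C A \<phi>) f
      \<in> homset set_cat (fob (set_ftor C A \<phi>) (src C f)) (fob (set_ftor C A \<phi>) (tgt C f))"
    if "f \<in> arr C" for f
    using that mem src_obj tgt_obj by (auto simp: set_ftor_def homset_set_cat)
  moreover have "far (set_ftor C A \<phi>) (ident C x) = ident set_cat (fob (set_ftor C A \<phi>) x)"
    if "x \<in> obj C" for x
    using that id ident_arr[OF that] by (auto simp: set_ftor_def restrict_def)
  moreover have "far (set_ftor C A \<phi>) (g \<cdot>\<^bsub>C\<^esub> f) =
      far (set_ftor C A \<phi>) g \<cdot>\<^bsub>set_cat\<^esub> far (set_ftor C A \<phi>) f"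
    if "f \<in> arr C" "g \<in> arr C" "src C g = tgt C f" for f g
    using that cmp_arr[OF that] comp[OF that] mem[OF that(1)]
    by (auto simp: set_ftor_def compose_def restrict_def fun_eq_iff)
  ultimately show ?thesis by (auto simp: is_functor_def set_ftor_def)
qed


section \<open>Natural transformations\<close>

lemma functor_cat_sel [simp]:
  "obj (functor_cat C D) = {F. is_functor C D F}"
  "src (functor_cat C D) = tsrc" "tgt (functor_cat C D) = ttgt"
  by (auto simp: functor_cat_def)

lemma functor_cat_ident:
  "ident (functor_cat C D) F = (F, F, \<lambda>x\<in>obj C. ident D (fob F x))"
  by (simp add: functor_cat_def)

lemma functor_cat_cmp:
  "s \<cdot>\<^bsub>functor_cat C D\<^esub> t = (tsrc t, ttgt s, \<lambda>x\<in>obj C. tmap s x \<cdot>\<^bsub>D\<^esub> tmap t x)"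
  by (simp add: functor_cat_def)

lemma homset_functor_cat:
  "t \<in> homset (functor_cat C set_cat) F G \<longleftrightarrow>
    tsrc t = F \<and> ttgt t = G \<and> is_functor C set_cat F \<and> is_functor C set_cat G \<and>
    tmap t \<in> extensional (obj C) \<and>
    (\<forall>x\<in>obj C. tmap t x \<in> homset set_cat (fob F x) (fob G x)) \<and>
    (\<forall>f\<in>arr C. tmap t (tgt C f) \<cdot>\<^bsub>set_cat\<^esub> far F f = far G f \<cdot>\<^bsub>set_cat\<^esub> tmap t (src C f))"
  by (cases t) (auto simp: homset_def functor_cat_def)

lemma nat_functors:
  assumes "t \<in> homset (functor_cat C set_cat) F G"
  shows "is_functor C set_cat F" "is_functor C set_cat G"
  using assms by (auto simp: homset_functor_cat)

lemma nat_components: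
  assumes "t \<in> homset (functor_cat C set_cat) F G" "x \<in> obj C"
  shows "tsrc (tmap t x) = fob F x" "ttgt (tmap t x) = fob G x"
    "app t x \<in> fob F x \<rightarrow>\<^sub>E fob G x"
  using assms unfolding homset_functor_cat homset_set_cat by blast+

lemma app_mem:
  "\<lbrakk>t \<in> homset (functor_cat C set_cat) F G; x \<in> obj C; e \<in> fob F x\<rbrakk> \<Longrightarrow> app t x e \<in> fob G x"
  by (auto simp: homset_functor_cat homset_set_cat)

lemma app_act:
  assumes C: "category C" and t: "t \<in> homset (functor_cat C set_cat) F G"
    and f: "f \<in> homset C x y" and e: "e \<in> fob F x"
  shows "app t y (act F f e) = act G f (app t x e)"
proof -
  interpret category C by fact
  have "tmap t (tgt C f) \<cdot>\<^bsub>set_cat\<^esub> far F f = far G f \<cdot>\<^bsub>set_cat\<^esub> tmap t (src C f)"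
    using t homsetD(1)[OF f] unfolding homset_functor_cat by blast
  then have "tmap (tmap t y \<cdot>\<^bsub>set_cat\<^esub> far F f) e = tmap (far G f \<cdot>\<^bsub>set_cat\<^esub> tmap t x) e"
    unfolding homsetD(2,3)[OF f] by (rule arg_cong[where f = "\<lambda>h. tmap h e"])
  moreover have "tsrc (far F f) = fob F x"
    using functor_far(1)[OF nat_functors(1)[OF t]] homsetD[OF f] by metis
  moreover have "tsrc (tmap t x) = fob F x"
    using t homset_obj[OF f] unfolding homset_functor_cat homset_set_cat by blast
  ultimately show ?thesis using e by (simp add: compose_def)
qed

lemma nat_eqI:
  assumes t: "t \<in> homset (functor_cat C set_cat) F G" and s: "s \<in> homset (functor_cat C set_cat) F G"
    and eq: "\<And>x e. x \<in> obj C \<Longrightarrow> e \<in> fob F x \<Longrightarrow> app t x e = app s x e"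
  shows "t = s"
proof -
  have "tmap t x = tmap s x" if x: "x \<in> obj C" for x
  proof -
    have h: "tmap t x \<in> homset set_cat (fob F x) (fob G x)"
        "tmap s x \<in> homset set_cat (fob F x) (fob G x)"
      using t s x unfolding homset_functor_cat by blast+
    then have "app t x \<in> fob F x \<rightarrow>\<^sub>E fob G x" "app s x \<in> fob F x \<rightarrow>\<^sub>E fob G x"
      unfolding homset_set_cat by blast+
    then have "app t x = app s x" using eq[OF x] by (rule PiE_ext)
    then show ?thesis using h by (simp add: homset_set_cat prod_eq_iff)
  qed
  moreover have "tmap t \<in> extensional (obj C)" "tmap s \<in> extensional (obj C)"
    using t s unfolding homset_functor_cat by blast+
  ultimately have "tmap t = tmap s" by (intro extensionalityI) auto
  then show ?thesis using t s by (simp add: homset_functor_cat prod_eq_iff)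
qed

text \<open>The counterpart of \<open>set_ftor\<close> for natural transformations:
  \<open>\<phi>\<close> is cut down to the sets of \<open>F\<close>, which leaves elementwise
  membership and naturality to verify.\<close>

definition nat_of ::
  "('o, 'a) cat \<Rightarrow> ('o, 'a, 's) setftor \<Rightarrow> ('o, 'a, 's) setftor \<Rightarrow> ('o \<Rightarrow> 's \<Rightarrow> 's) \<Rightarrow>
    ('o, 'a, 's) setnat" where
  "nat_of C F G \<phi> = (F, G, \<lambda>x\<in>obj C. (fob F x, fob G x, \<lambda>e\<in>fob F x. \<phi> x e))"

lemma app_nat_of [simp]: "x \<in> obj C \<Longrightarrow> e \<in> fob F x \<Longrightarrow> app (nat_of C F G \<phi>) x e = \<phi> x e"
  by (simp add: nat_of_def)

lemma nat_of_hom: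
  assumes "category C" and F: "is_functor C set_cat F" and G: "is_functor C set_cat G"
    and mem: "\<And>x e. x \<in> obj C \<Longrightarrow> e \<in> fob F x \<Longrightarrow> \<phi> x e \<in> fob G x"
    and natural: "\<And>x y f e. f \<in> homset C x y \<Longrightarrow> e \<in> fob F x \<Longrightarrow>
      \<phi> y (act F f e) = act G f (\<phi> x e)"
  shows "nat_of C F G \<phi> \<in> homset (functor_cat C set_cat) F G"
proof -
  interpret category C by fact
  have nat: "tmap (nat_of C F G \<phi>) (tgt C f) \<cdot>\<^bsub>set_cat\<^esub> far F f =
      far G f \<cdot>\<^bsub>set_cat\<^esub> tmap (nat_of C F G \<phi>) (src C f)" if f: "f \<in> arr C" for f
  proof -
    have "(\<lambda>e\<in>fob F (src C f). (\<lambda>e\<in>fob F (tgt C f). \<phi> (tgt C f) e) (act F f e)) =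
        (\<lambda>e\<in>fob F (src C f). act G f ((\<lambda>e\<in>fob F (src C f). \<phi> (src C f) e) e))"
      using natural[OF arr_homset[OF f]] act_mem[OF F arr_homset[OF f]] by (intro restrict_ext) simp
    then show ?thesis
      using functor_far(1,2)[OF F f] functor_far(1,2)[OF G f] src_obj[OF f] tgt_obj[OF f]
      by (simp add: nat_of_def compose_def)
  qed
  have "tmap (nat_of C F G \<phi>) x \<in> homset set_cat (fob F x) (fob G x)" if "x \<in> obj C" for x
    using mem[OF that] that by (simp add: homset_set_cat nat_of_def)
  moreover have "tsrc (nat_of C F G \<phi>) = F" "ttgt (nat_of C F G \<phi>) = G"
    "tmap (nat_of C F G \<phi>) \<in> extensional (obj C)"
    by (simp_all add: nat_of_def)
  ultimately show ?thesis unfolding homset_functor_cat using F G nat by blast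
qed

lemma app_cmp:
  assumes "t \<in> homset (functor_cat C set_cat) F G" "x \<in> obj C" "e \<in> fob F x"
  shows "app (s \<cdot>\<^bsub>functor_cat C set_cat\<^esub> t) x e = app s x (app t x e)"
  using assms(2,3) nat_components(1)[OF assms(1,2)] by (simp add: functor_cat_cmp compose_def)

lemma app_ident:
  assumes "x \<in> obj C" "e \<in> fob F x"
  shows "app (ident (functor_cat C set_cat) F) x e = e"
  using assms by (simp add: functor_cat_ident)

lemma category_functor_cat:
  assumes C: "category C"
  shows "category (functor_cat C set_cat)"
proof -
  interpret category C by fact
  let ?P = "functor_cat C set_cat"
  have cmp: "g \<cdot>\<^bsub>?P\<^esub> f \<in> homset ?P x z" if f: "f \<in> homset ?P x y" and g: "g \<in> homset ?P y z"
    for f g x y z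
  proof -
    \<comment> \<open>As an instance of \<open>nat_of\<close> the composite is natural as soon as it
      is so on elements.\<close>
    have "g \<cdot>\<^bsub>?P\<^esub> f = nat_of C x z (\<lambda>a e. app g a (app f a e))"
    proof -
      have "tsrc f = x" "ttgt g = z" using f g by (simp_all add: homset_functor_cat)
      moreover have "(\<lambda>a\<in>obj C. tmap g a \<cdot>\<^bsub>set_cat\<^esub> tmap f a) =
          (\<lambda>a\<in>obj C. (fob x a, fob z a, \<lambda>e\<in>fob x a. app g a (app f a e)))"
        using nat_components(1)[OF f] nat_components(2)[OF g]
        by (intro restrict_ext) (simp add: compose_def)
      ultimately show ?thesis by (simp add: functor_cat_cmp nat_of_def)
    qed
    moreover have "nat_of C x z (\<lambda>a e. app g a (app f a e)) \<in> homset ?P x z"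
    proof (rule nat_of_hom[OF C nat_functors(1)[OF f] nat_functors(2)[OF g]])
      show "app g b (app f b (act x h e)) = act z h (app g a (app f a e))"
        if h: "h \<in> homset C a b" and e: "e \<in> fob x a" for h a b e
        using app_act[OF C f h e] app_act[OF C g h app_mem[OF f homset_obj(1)[OF h] e]] by simp
    qed (use app_mem[OF f] app_mem[OF g] in blast)
    ultimately show ?thesis by simp
  qed
  have id: "ident ?P x \<in> homset ?P x x" if x: "x \<in> obj ?P" for x
  proof -
    have "ident ?P x = nat_of C x x (\<lambda>a e. e)"
      unfolding functor_cat_ident nat_of_def by (simp cong: restrict_cong)
    moreover have "nat_of C x x (\<lambda>a e. e) \<in> homset ?P x x"
      using x by (intro nat_of_hom[OF C]) auto
    ultimately show ?thesis by simp
  qed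
  show ?thesis
  proof
    show "f \<cdot>\<^bsub>?P\<^esub> ident ?P x = f" if f: "f \<in> homset ?P x y" for f x y
      using f id[of x] nat_functors[OF f] cmp[of "ident ?P x" x x f y]
      by (intro nat_eqI[of _ _ x y]) (auto simp: app_cmp[of _ C x x] app_ident)
    show "ident ?P y \<cdot>\<^bsub>?P\<^esub> f = f" if f: "f \<in> homset ?P x y" for f x y
      using f id[of y] nat_functors[OF f] cmp[of f x y "ident ?P y" y] app_mem[OF f]
      by (intro nat_eqI[of _ _ x y]) (auto simp: app_cmp[of _ C x y] app_ident)
    show "(h \<cdot>\<^bsub>?P\<^esub> g) \<cdot>\<^bsub>?P\<^esub> f = h \<cdot>\<^bsub>?P\<^esub> (g \<cdot>\<^bsub>?P\<^esub> f)"
      if f: "f \<in> homset ?P w x" and g: "g \<in> homset ?P x y" and h: "h \<in> homset ?P y z"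
      for f g h w x y z
      using cmp[OF f cmp[OF g h]] cmp[OF cmp[OF f g] h] app_mem[OF f]
      by (intro nat_eqI[of _ _ w z])
        (auto simp: app_cmp[OF cmp[OF f g]] app_cmp[OF f] app_cmp[OF g])
    show "\<And>f. f \<in> arr ?P \<Longrightarrow> src ?P f \<in> obj ?P" "\<And>f. f \<in> arr ?P \<Longrightarrow> tgt ?P f \<in> obj ?P"
      by (auto simp: functor_cat_def)
  qed (use cmp id in auto)
qed

section \<open>Full subcategories\<close>

lemma full_subcat_sel [simp]:
  "obj (full_subcat C X) = obj C \<inter> X" "src (full_subcat C X) = src C"
  "tgt (full_subcat C X) = tgt C" "ident (full_subcat C X) = ident C"
  "g \<cdot>\<^bsub>full_subcat C X\<^esub> f = g \<cdot>\<^bsub>C\<^esub> f"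
  by (auto simp: full_subcat_def)

lemma homset_full_subcat:
  "f \<in> homset (full_subcat C X) x y \<longleftrightarrow> x \<in> X \<and> y \<in> X \<and> f \<in> homset C x y"
  by (auto simp: full_subcat_def homset_def)

lemma category_full_subcat:
  assumes "category C"
  shows "category (full_subcat C X)"
proof -
  interpret category C by fact
  show ?thesis
  proof
    show "\<And>f. f \<in> arr (full_subcat C X) \<Longrightarrow> src (full_subcat C X) f \<in> obj (full_subcat C X)"
      "\<And>f. f \<in> arr (full_subcat C X) \<Longrightarrow> tgt (full_subcat C X) f \<in> obj (full_subcat C X)"
      using src_obj tgt_obj by (auto simp: full_subcat_def)
  qed (auto simp: homset_full_subcat intro: ident_hom cmp_hom cmp_ident_right cmp_ident_left cmp_assoc)
qed


section \<open>Preservation of pullbacks, elementwise\<close>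

lemma restrict_eq_iff: "restrict f A = restrict g A \<longleftrightarrow> (\<forall>x\<in>A. f x = g x)"
proof
  assume eq: "restrict f A = restrict g A"
  show "\<forall>x\<in>A. f x = g x"
  proof
    fix x assume "x \<in> A"
    with fun_cong[OF eq, of x] show "f x = g x" by simp
  qed
next
  assume "\<forall>x\<in>A. f x = g x"
  then show "restrict f A = restrict g A" by (intro restrict_ext) blast
qed

lemma set_cat_cmp_eq_iff:
  assumes "k \<in> homset set_cat W A" "f \<in> homset set_cat A Z"
    and "l \<in> homset set_cat W B" "g \<in> homset set_cat B Z"
  shows "f \<cdot>\<^bsub>set_cat\<^esub> k = g \<cdot>\<^bsub>set_cat\<^esub> l \<longleftrightarrow> (\<forall>e\<in>W. tmap f (tmap k e) = tmap g (tmap l e))"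
  using assms by (simp add: homset_set_cat compose_def restrict_eq_iff)

lemma set_cat_cmp_eq_iff':
  assumes "k \<in> homset set_cat W A" "f \<in> homset set_cat A Z" "h \<in> homset set_cat W Z"
  shows "f \<cdot>\<^bsub>set_cat\<^esub> k = h \<longleftrightarrow> (\<forall>e\<in>W. tmap f (tmap k e) = tmap h e)"
proof -
  have h: "tsrc h = W" "ttgt h = Z" "restrict (tmap h) W = tmap h"
    using assms(3) by (simp_all add: homset_set_cat PiE_def extensional_restrict)
  have "compose W (tmap f) (tmap k) = tmap h \<longleftrightarrow> (\<forall>e\<in>W. tmap f (tmap k e) = tmap h e)"
    unfolding compose_def using restrict_eq_iff[of "\<lambda>e. tmap f (tmap k e)" W "tmap h"] h(3) by simp
  then show ?thesis using assms(1,2) h(1,2) by (simp add: homset_set_cat prod_eq_iff)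
qed

text \<open>Elements are maps from a one-element set, which reduces the universal property to single
  pairs \<open>a\<close>, \<open>b\<close>; conversely the unique elements over all values of two
  maps assemble into the mediating map.\<close>

lemma is_pullback_set_cat_iff:
  fixes A B P Z :: "'s set"
  assumes f: "f \<in> homset set_cat A Z" and g: "g \<in> homset set_cat B Z"
    and p: "p \<in> homset set_cat P A" and q: "q \<in> homset set_cat P B"
  shows "is_pullback set_cat f g p q \<longleftrightarrow>
    (\<forall>e\<in>P. tmap f (tmap p e) = tmap g (tmap q e)) \<and>
    (\<forall>a\<in>A. \<forall>b\<in>B. tmap f a = tmap g b \<longrightarrow> (\<exists>!e. e \<in> P \<and> tmap p e = a \<and> tmap q e = b))"
    (is "?L \<longleftrightarrow> ?R")
proof -
  have pb: "?L \<longleftrightarrow> f \<cdot>\<^bsub>set_cat\<^esub> p = g \<cdot>\<^bsub>set_cat\<^esub> q \<and>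
      (\<forall>W. \<forall>a\<in>homset set_cat W A. \<forall>b\<in>homset set_cat W B. f \<cdot>\<^bsub>set_cat\<^esub> a = g \<cdot>\<^bsub>set_cat\<^esub> b \<longrightarrow>
        (\<exists>!k. k \<in> homset set_cat W P \<and> p \<cdot>\<^bsub>set_cat\<^esub> k = a \<and> q \<cdot>\<^bsub>set_cat\<^esub> k = b))"
    using homsetD[OF f] homsetD[OF g] homsetD[OF p] homsetD[OF q]
    by (simp add: is_pullback_def del: set_cat_sel(2-))
  show ?thesis
  proof
    assume ?L
    then have comm: "f \<cdot>\<^bsub>set_cat\<^esub> p = g \<cdot>\<^bsub>set_cat\<^esub> q"
      and univ: "\<And>W a b. a \<in> homset set_cat W A \<Longrightarrow> b \<in> homset set_cat W B \<Longrightarrow>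
        f \<cdot>\<^bsub>set_cat\<^esub> a = g \<cdot>\<^bsub>set_cat\<^esub> b \<Longrightarrow>
        \<exists>!k. k \<in> homset set_cat W P \<and> p \<cdot>\<^bsub>set_cat\<^esub> k = a \<and> q \<cdot>\<^bsub>set_cat\<^esub> k = b"
      unfolding pb by blast+
    have "\<exists>!e. e \<in> P \<and> tmap p e = a \<and> tmap q e = b"
      if ab: "a \<in> A" "b \<in> B" "tmap f a = tmap g b" for a b
    proof -
      \<comment> \<open>The one-element test object is \<open>{a}\<close>; both constant maps are
        defined on it so that they form a cone.\<close>
      define a' b' where "a' = ({a}, A, \<lambda>_\<in>{a}. a)" and "b' = ({a}, B, \<lambda>_\<in>{a}. b)"
      have h: "a' \<in> homset set_cat {a} A" "b' \<in> homset set_cat {a} B"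
        and val: "tmap a' a = a" "tmap b' a = b"
        using ab by (simp_all add: homset_set_cat a'_def b'_def)
      have "f \<cdot>\<^bsub>set_cat\<^esub> a' = g \<cdot>\<^bsub>set_cat\<^esub> b'"
        unfolding set_cat_cmp_eq_iff[OF h(1) f h(2) g] using ab val by simp
      from univ[OF h this] obtain k where k: "k \<in> homset set_cat {a} P"
          "p \<cdot>\<^bsub>set_cat\<^esub> k = a'" "q \<cdot>\<^bsub>set_cat\<^esub> k = b'"
        and u: "\<And>k'. k' \<in> homset set_cat {a} P \<Longrightarrow> p \<cdot>\<^bsub>set_cat\<^esub> k' = a' \<Longrightarrow> q \<cdot>\<^bsub>set_cat\<^esub> k' = b' \<Longrightarrow> k' = k"
        by blast
      have iff: "p \<cdot>\<^bsub>set_cat\<^esub> k' = a' \<longleftrightarrow> tmap p (tmap k' a) = a"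
        "q \<cdot>\<^bsub>set_cat\<^esub> k' = b' \<longleftrightarrow> tmap q (tmap k' a) = b" if k': "k' \<in> homset set_cat {a} P" for k'
        unfolding set_cat_cmp_eq_iff'[OF k' p h(1)] set_cat_cmp_eq_iff'[OF k' q h(2)]
        using val by simp_all
      show ?thesis
      proof (rule ex1I[of _ "tmap k a"])
        show "tmap k a \<in> P \<and> tmap p (tmap k a) = a \<and> tmap q (tmap k a) = b"
          using k iff[OF k(1)] by (auto simp: homset_set_cat simp del: set_cat_sel)
        fix e assume e: "e \<in> P \<and> tmap p e = a \<and> tmap q e = b"
        define k' where "k' = ({a}, P, \<lambda>_\<in>{a}. e)"
        have k': "k' \<in> homset set_cat {a} P" and v: "tmap k' a = e"
          using e by (simp_all add: homset_set_cat k'_def)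
        have "k' = k" using u[OF k'] iff[OF k'] v e by simp
        then show "e = tmap k a" using v by simp
      qed
    qed
    with comm show ?R unfolding set_cat_cmp_eq_iff[OF p f q g] by blast
  next
    assume R: ?R
    have "\<exists>!k. k \<in> homset set_cat W P \<and> p \<cdot>\<^bsub>set_cat\<^esub> k = a \<and> q \<cdot>\<^bsub>set_cat\<^esub> k = b"
      if a: "a \<in> homset set_cat W A" and b: "b \<in> homset set_cat W B"
        and ab: "f \<cdot>\<^bsub>set_cat\<^esub> a = g \<cdot>\<^bsub>set_cat\<^esub> b" for W a b
    proof -
      have ab: "tmap f (tmap a e) = tmap g (tmap b e)" "tmap a e \<in> A" "tmap b e \<in> B" if "e \<in> W" for e
        using a b ab that unfolding set_cat_cmp_eq_iff[OF a f b g]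
        by (auto simp: homset_set_cat)
      have ex: "\<exists>!z. z \<in> P \<and> tmap p z = tmap a e \<and> tmap q z = tmap b e" if "e \<in> W" for e
        using R ab[OF that] by blast
      \<comment> \<open>Unique existence at every \<open>e\<close> makes the definite description
        meaningful, and later forces \<open>k' = k\<close> pointwise.\<close>
      define k where "k = (W, P, \<lambda>e\<in>W. THE z. z \<in> P \<and> tmap p z = tmap a e \<and> tmap q z = tmap b e)"
      have k: "tmap k e \<in> P \<and> tmap p (tmap k e) = tmap a e \<and> tmap q (tmap k e) = tmap b e"
        if "e \<in> W" for e
        using theI'[OF ex[OF that]] that by (simp add: k_def)
      have kP: "k \<in> homset set_cat W P" using k by (auto simp: k_def homset_set_cat)
      show ?thesis
      proof (rule ex1I[of _ k])
        show "k \<in> homset set_cat W P \<and> p \<cdot>\<^bsub>set_cat\<^esub> k = a \<and> q \<cdot>\<^bsub>set_cat\<^esub> k = b"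
          unfolding set_cat_cmp_eq_iff'[OF kP p a] set_cat_cmp_eq_iff'[OF kP q b] using k kP by blast
        fix k' assume "k' \<in> homset set_cat W P \<and> p \<cdot>\<^bsub>set_cat\<^esub> k' = a \<and> q \<cdot>\<^bsub>set_cat\<^esub> k' = b"
        then have k'P: "k' \<in> homset set_cat W P"
          and k': "p \<cdot>\<^bsub>set_cat\<^esub> k' = a" "q \<cdot>\<^bsub>set_cat\<^esub> k' = b" by blast+
        have P: "tmap k \<in> W \<rightarrow>\<^sub>E P" "tmap k' \<in> W \<rightarrow>\<^sub>E P"
          using kP k'P unfolding homset_set_cat by blast+
        have "tmap k' e = tmap k e" if e: "e \<in> W" for e
        proof -
          have "tmap k' e \<in> P \<and> tmap p (tmap k' e) = tmap a e \<and> tmap q (tmap k' e) = tmap b e"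
            using k'[unfolded set_cat_cmp_eq_iff'[OF k'P p a] set_cat_cmp_eq_iff'[OF k'P q b]] P e
            by blast
          then show ?thesis using ex[OF e] k[OF e] by blast
        qed
        then have "tmap k' = tmap k" using P by (intro PiE_ext[of "tmap k'" W "\<lambda>_. P"])
        then show "k' = k" using kP k'P by (simp add: homset_set_cat prod_eq_iff)
      qed
    qed
    then show ?L unfolding pb set_cat_cmp_eq_iff[OF p f q g] using R by blast
  qed
qed

text \<open>Functoriality makes the image of a commuting square commute, so of the criterion for
  sets just unique existence remains.\<close>

lemma preserves_pullbacks_set_iff:
  assumes C: "category C" and F: "is_functor C set_cat F"
  shows "preserves_pullbacks C set_cat F \<longleftrightarrow>
    (\<forall>f g p q. is_pullback C f g p q \<longrightarrow>
      (\<forall>a\<in>fob F (src C f). \<forall>b\<in>fob F (src C g). act F f a = act F g b \<longrightarrow>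
        (\<exists>!e. e \<in> fob F (src C p) \<and> act F p e = a \<and> act F q e = b)))"
proof -
  interpret category C by fact
  have "is_pullback set_cat (far F f) (far F g) (far F p) (far F q) \<longleftrightarrow>
      (\<forall>a\<in>fob F (src C f). \<forall>b\<in>fob F (src C g). act F f a = act F g b \<longrightarrow>
        (\<exists>!e. e \<in> fob F (src C p) \<and> act F p e = a \<and> act F q e = b))"
    if pb: "is_pullback C f g p q" for f g p q
  proof -
    have arrs: "f \<in> homset C (src C f) (tgt C f)" "g \<in> homset C (src C g) (tgt C f)"
      "p \<in> homset C (src C p) (src C f)" "q \<in> homset C (src C p) (src C g)" "f \<cdot>\<^bsub>C\<^esub> p = g \<cdot>\<^bsub>C\<^esub> q"
      using pb by (auto simp: is_pullback_def homset_def)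
    have far: "far F h \<in> homset set_cat (fob F x) (fob F y)" if "h \<in> homset C x y" for h x y
      using F that by (auto simp: is_functor_def homset_def simp del: set_cat_sel)
    have "act F f (act F p e) = act F g (act F q e)" if "e \<in> fob F (src C p)" for e
      using act_cmp[OF F arrs(3,1) that] act_cmp[OF F arrs(4,2) that] arrs(5) by simp
    then show ?thesis
      using is_pullback_set_cat_iff[OF far[OF arrs(1)] far[OF arrs(2)] far[OF arrs(3)] far[OF arrs(4)]]
      by blast
  qed
  then show ?thesis unfolding preserves_pullbacks_def by (simp cong: imp_cong)
qed

lemma preserves_pullbacksD:
  assumes "category C" "is_functor C set_cat F" "preserves_pullbacks C set_cat F"
    and "is_pullback C f g p q" "a \<in> fob F (src C f)" "b \<in> fob F (src C g)" "act F f a = act F g b"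
  obtains e where "e \<in> fob F (src C p)" "act F p e = a" "act F q e = b"
  using assms preserves_pullbacks_set_iff[OF assms(1,2)] by blast

lemma (in category) is_pullback_kernel_pair_mono:
  assumes "is_mono C f"
  shows "is_pullback C f f (ident C (src C f)) (ident C (src C f))"
proof -
  have f: "f \<in> arr C" using assms by (simp add: is_mono_def)
  have "\<exists>!k. k \<in> homset C w (src C f) \<and> ident C (src C f) \<cdot>\<^bsub>C\<^esub> k = a \<and> ident C (src C f) \<cdot>\<^bsub>C\<^esub> k = b"
    if "a \<in> homset C w (src C f)" "b \<in> homset C w (src C f)" "f \<cdot>\<^bsub>C\<^esub> a = f \<cdot>\<^bsub>C\<^esub> b" for w a b
  proof -
    have "a = b" using assms that homset_obj(1)[OF that(1)] unfolding is_mono_def by blast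
    then show ?thesis using that cmp_ident_left by auto
  qed
  then show ?thesis using f ident_arr[OF src_obj[OF f]] by (simp add: is_pullback_def)
qed

text \<open>The kernel pair of a mono is a pair of identities. Elements with the same image thus
  come from one element along two identities, and coincide.\<close>

lemma act_inj_of_mono:
  assumes C: "category C" and F: "is_functor C set_cat F" and pp: "preserves_pullbacks C set_cat F"
    and f: "is_mono C f"
  shows "inj_on (act F f) (fob F (src C f))"
proof (rule inj_onI)
  interpret category C by fact
  fix a b assume a: "a \<in> fob F (src C f)" and b: "b \<in> fob F (src C f)" and eq: "act F f a = act F f b"
  have x: "src C f \<in> obj C" using f src_obj by (simp add: is_mono_def)
  obtain e where "e \<in> fob F (src C (ident C (src C f)))" "act F (ident C (src C f)) e = a"
    "act F (ident C (src C f)) e = b"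
    using preserves_pullbacksD[OF C F pp is_pullback_kernel_pair_mono[OF f] a b eq] .
  then show "a = b" by simp
qed


section \<open>Sheaves for the atomic topology\<close>

text \<open>The Ore condition for the opposite category. It is what makes the non-empty sieves there
  stable under pullback.\<close>

definition spans_have_cocones :: "('o, 'a) cat \<Rightarrow> bool" where
  "spans_have_cocones C \<longleftrightarrow> (\<forall>f\<in>arr C. \<forall>g\<in>arr C. src C f = src C g \<longrightarrow>
     (\<exists>h\<in>arr C. \<exists>k\<in>arr C. src C h = tgt C f \<and> src C k = tgt C g \<and> h \<cdot>\<^bsub>C\<^esub> f = k \<cdot>\<^bsub>C\<^esub> g))"

lemma sieve_opcat:
  "sieve (opcat C) c S \<longleftrightarrow> S \<subseteq> {f \<in> arr C. src C f = c} \<and>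
    (\<forall>f\<in>S. \<forall>g\<in>arr C. src C g = tgt C f \<longrightarrow> g \<cdot>\<^bsub>C\<^esub> f \<in> S)"
  by (simp add: sieve_def)

text \<open>The principal sieve generated by \<open>f\<close> in the opposite category.\<close>

definition cosieve_of :: "('o, 'a) cat \<Rightarrow> 'a \<Rightarrow> 'a set" where
  "cosieve_of C f = {k \<cdot>\<^bsub>C\<^esub> f | k. k \<in> arr C \<and> src C k = tgt C f}"

lemma sieve_cosieve_of:
  assumes "category C" "f \<in> arr C"
  shows "sieve (opcat C) (src C f) (cosieve_of C f)" "f \<in> cosieve_of C f"
proof -
  interpret category C by fact
  show "sieve (opcat C) (src C f) (cosieve_of C f)"
    unfolding sieve_opcat
  proof (intro conjI ballI impI)
    show "cosieve_of C f \<subseteq> {h \<in> arr C. src C h = src C f}"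
      using assms(2) by (auto simp: cosieve_of_def cmp_arr)
    fix h g assume "h \<in> cosieve_of C f" and g: "g \<in> arr C" "src C g = tgt C h"
    then obtain k where k: "k \<in> arr C" "src C k = tgt C f" "h = k \<cdot>\<^bsub>C\<^esub> f" by (auto simp: cosieve_of_def)
    then have "g \<cdot>\<^bsub>C\<^esub> h = (g \<cdot>\<^bsub>C\<^esub> k) \<cdot>\<^bsub>C\<^esub> f" using g assms(2) by (simp add: assoc_arr cmp_arr)
    then show "g \<cdot>\<^bsub>C\<^esub> h \<in> cosieve_of C f"
      using k g assms(2) by (auto simp: cosieve_of_def cmp_arr)
  qed
  have "ident C (tgt C f) \<cdot>\<^bsub>C\<^esub> f = f" using assms(2) by (simp add: ident_cmp_arr)
  then show "f \<in> cosieve_of C f"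
    using ident_arr[OF tgt_obj[OF assms(2)]] by (force simp: cosieve_of_def)
qed

lemma mem_atomic_topology:
  assumes "sieve D c S" "S \<noteq> {}" "c \<in> obj D"
  shows "S \<in> atomic_topology D c"
  using assms by (auto simp: atomic_topology_def generated_topology_def)

text \<open>Cocones make the non-empty sieves a Grothendieck topology already, so generation adds
  nothing to them.\<close>

lemma atomic_topology_opcat:
  assumes C: "category C" and ore: "spans_have_cocones C" and c: "c \<in> obj C"
  shows "S \<in> atomic_topology (opcat C) c \<longleftrightarrow> sieve (opcat C) c S \<and> S \<noteq> {}"
proof
  interpret category C by fact
  let ?J = "\<lambda>c. {S. sieve (opcat C) c S \<and> S \<noteq> {}}"
  have "grothendieck_topology (opcat C) ?J"
    unfolding grothendieck_topology_def
  proof (intro conjI ballI allI impI)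
    show "sieve (opcat C) c S" if "S \<in> ?J c" for c S using that by simp
    show "{f \<in> arr (opcat C). tgt (opcat C) f = c} \<in> ?J c" if "c \<in> obj (opcat C)" for c
      using that ident_arr[of c] by (auto simp: sieve_opcat cmp_arr)
    show "pullback_sieve (opcat C) f S \<in> ?J (src (opcat C) f)"
      if S: "S \<in> ?J c" and f: "f \<in> arr (opcat C)" "tgt (opcat C) f = c" for c S f
    proof -
      from S obtain g where g: "g \<in> S" by blast
      have S': "S \<subseteq> {f \<in> arr C. src C f = c}" and cl: "\<And>f g. f \<in> S \<Longrightarrow> g \<in> arr C \<Longrightarrow> src C g = tgt C f \<Longrightarrow> g \<cdot>\<^bsub>C\<^esub> f \<in> S"
        using S by (auto simp: sieve_opcat)
      have fC: "f \<in> arr C" "src C f = c" using f by simp_all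
      have gC: "g \<in> arr C" "src C g = c" using S' g by auto
      \<comment> \<open>A cocone over \<open>f\<close> and a member \<open>g\<close> of
        \<open>S\<close> gives \<open>h \<cdot> f = k \<cdot> g\<close>, and the right side lies in
        \<open>S\<close>; hence \<open>h\<close> witnesses that the pulled back sieve is
        non-empty.\<close>
      obtain h k where hk: "h \<in> arr C" "k \<in> arr C" "src C h = tgt C f" "src C k = tgt C g"
        "h \<cdot>\<^bsub>C\<^esub> f = k \<cdot>\<^bsub>C\<^esub> g"
        using ore fC gC unfolding spans_have_cocones_def by metis
      have "h \<in> pullback_sieve (opcat C) f S"
        using hk cl[OF g hk(2,4)] by (simp add: pullback_sieve_def)
      moreover have "g' \<cdot>\<^bsub>C\<^esub> f' \<in> pullback_sieve (opcat C) f S"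
        if "f' \<in> pullback_sieve (opcat C) f S" "g' \<in> arr C" "src C g' = tgt C f'" for f' g'
        using that fC cl[of "f' \<cdot>\<^bsub>C\<^esub> f" g'] by (simp add: pullback_sieve_def cmp_arr assoc_arr)
      ultimately show ?thesis by (auto simp: sieve_opcat pullback_sieve_def)
    qed
    show "R \<in> ?J c" if "S \<in> ?J c"
      and R: "sieve (opcat C) c R \<and> (\<forall>f\<in>S. pullback_sieve (opcat C) f R \<in> ?J (src (opcat C) f))"
      for c S R
    proof -
      from that obtain f where "f \<in> S" by blast
      \<comment> \<open>Transitivity: any member of a pullback of \<open>R\<close> produces a member
        of \<open>R\<close> itself.\<close>
      then have "pullback_sieve (opcat C) f R \<noteq> {}" using R by blast
      then show ?thesis using R by (auto simp: pullback_sieve_def)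
    qed
  qed
  moreover assume "S \<in> atomic_topology (opcat C) c"
  ultimately show "sieve (opcat C) c S \<and> S \<noteq> {}"
    unfolding atomic_topology_def generated_topology_def by auto
next
  assume "sieve (opcat C) c S \<and> S \<noteq> {}"
  then show "S \<in> atomic_topology (opcat C) c" using c by (intro mem_atomic_topology) auto
qed

text \<open>Pulling the principal cosieve of \<open>f\<close> back along \<open>g\<close> leaves
  exactly the arrows that complete a cocone, hence nothing. Every topology in which the non-empty
  sieves cover must therefore contain the empty sieve on the target of \<open>g\<close>.\<close>

lemma empty_mem_atomic_topology:
  assumes C: "category C" and f: "f \<in> arr C" and g: "g \<in> arr C" and src: "src C f = src C g"
    and no: "\<And>h k. h \<in> arr C \<Longrightarrow> k \<in> arr C \<Longrightarrow> src C h = tgt C f \<Longrightarrow> src C k = tgt C g \<Longrightarrow>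
      h \<cdot>\<^bsub>C\<^esub> f \<noteq> k \<cdot>\<^bsub>C\<^esub> g"
  shows "{} \<in> atomic_topology (opcat C) (tgt C g)"
proof -
  interpret category C by fact
  have S: "sieve (opcat C) (src C g) (cosieve_of C f)" "f \<in> cosieve_of C f"
    using sieve_cosieve_of[OF C f] src by auto
  have empty: "pullback_sieve (opcat C) g (cosieve_of C f) = {}"
    using no by (fastforce simp: pullback_sieve_def cosieve_of_def)
  have "{} \<in> J (tgt C g)" if J: "grothendieck_topology (opcat C) J"
    and K: "\<forall>d\<in>obj (opcat C). {S. sieve (opcat C) d S \<and> S \<noteq> {}} \<subseteq> J d" for J
  proof -
    have o: "src C g \<in> obj (opcat C)" using src_obj[OF g] by simp
    have "cosieve_of C f \<in> J (src C g)" using K o S by blast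
    moreover have "\<forall>c\<in>obj (opcat C). \<forall>S\<in>J c. \<forall>f\<in>arr (opcat C). tgt (opcat C) f = c \<longrightarrow>
        pullback_sieve (opcat C) f S \<in> J (src (opcat C) f)"
      using J unfolding grothendieck_topology_def by blast
    ultimately have "pullback_sieve (opcat C) g (cosieve_of C f) \<in> J (src (opcat C) g)"
      using o g by simp
    then show ?thesis by (simp add: empty)
  qed
  then show ?thesis by (auto simp: atomic_topology_def generated_topology_def)
qed

text \<open>Such an \<open>e\<close> is the value at \<open>f\<close> of a matching family on the
  cosieve generated by \<open>f\<close>, and it determines that family.\<close>

definition self_matching :: "('o, 'a) cat \<Rightarrow> ('o, 'a, 's) setftor \<Rightarrow> 'a \<Rightarrow> 's \<Rightarrow> bool" where
  "self_matching C F f e \<longleftrightarrow> e \<in> fob F (tgt C f) \<and>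
     (\<forall>X. \<forall>\<alpha>\<in>homset C (tgt C f) X. \<forall>\<beta>\<in>homset C (tgt C f) X.
        \<alpha> \<cdot>\<^bsub>C\<^esub> f = \<beta> \<cdot>\<^bsub>C\<^esub> f \<longrightarrow> act F \<alpha> e = act F \<beta> e)"

text \<open>Every non-empty sieve contains the cosieve of each of its members \<open>f\<close>, so
  gluing over such principal cosieves gives a candidate in general; the other members are compared
  with it through cocones, where injectivity of the actions applies.\<close>

lemma is_sheaf_atomic_iff:
  assumes C: "category C" and ore: "spans_have_cocones C"
  shows "is_sheaf (opcat C) (atomic_topology (opcat C)) F \<longleftrightarrow>
    is_functor C set_cat F \<and>
    (\<forall>f\<in>arr C. inj_on (act F f) (fob F (src C f)) \<and>
      (\<forall>e. self_matching C F f e \<longrightarrow> e \<in> act F f ` fob F (src C f)))"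
  (is "?L \<longleftrightarrow> _ \<and> ?R")
proof -
  interpret category C by fact
  let ?amalg = "\<lambda>c S x. (\<forall>f\<in>S. x f \<in> fob F (tgt C f)) \<and>
        (\<forall>f\<in>S. \<forall>g\<in>arr C. src C g = tgt C f \<longrightarrow> act F g (x f) = x (g \<cdot>\<^bsub>C\<^esub> f)) \<longrightarrow>
        (\<exists>!y. y \<in> fob F c \<and> (\<forall>f\<in>S. act F f y = x f))"
  have sheaf: "?L \<longleftrightarrow> is_functor C set_cat F \<and>
      (\<forall>c\<in>obj C. \<forall>S. sieve (opcat C) c S \<and> S \<noteq> {} \<longrightarrow> (\<forall>x. ?amalg c S x))"
    unfolding is_sheaf_def opcat_sel opcat_opcat
    by (intro arg_cong2[where f = "(\<and>)"] refl ball_cong)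
      (simp add: Ball_def atomic_topology_opcat[OF C ore])
  show ?thesis
  proof
    assume ?L
    then have F: "is_functor C set_cat F"
      and am: "\<And>c S x. c \<in> obj C \<Longrightarrow> sieve (opcat C) c S \<Longrightarrow> S \<noteq> {} \<Longrightarrow> ?amalg c S x"
      unfolding sheaf by blast+
    have "inj_on (act F f) (fob F (src C f)) \<and>
      (\<forall>e. self_matching C F f e \<longrightarrow> e \<in> act F f ` fob F (src C f))" if f: "f \<in> arr C" for f
    proof (intro conjI allI impI)
      note S = sieve_cosieve_of[OF C f]
      have ex: "\<exists>!y. y \<in> fob F (src C f) \<and> (\<forall>h\<in>cosieve_of C f. act F h y = x h)"
        if "\<And>h. h \<in> cosieve_of C f \<Longrightarrow> x h \<in> fob F (tgt C h)"
          "\<And>h g. h \<in> cosieve_of C f \<Longrightarrow> g \<in> arr C \<Longrightarrow> src C g = tgt C h \<Longrightarrow> act F g (x h) = x (g \<cdot>\<^bsub>C\<^esub> h)"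
        for x
        using am[OF src_obj[OF f] S(1), of x] S(2) that by blast
      show "inj_on (act F f) (fob F (src C f))"
      proof (rule inj_onI)
        fix a b assume a: "a \<in> fob F (src C f)" and b: "b \<in> fob F (src C f)"
          and eq: "act F f a = act F f b"
        have hs: "h \<in> homset C (src C f) (tgt C h)" if "h \<in> cosieve_of C f" for h
          using S(1) that by (auto simp: sieve_opcat homset_def)
        have "act F h a = act F h b" if h: "h \<in> cosieve_of C f" for h
        proof -
          obtain k where k: "k \<in> arr C" "src C k = tgt C f" "h = k \<cdot>\<^bsub>C\<^esub> f"
            using h by (auto simp: cosieve_of_def)
          have k': "k \<in> homset C (tgt C f) (tgt C k)" using k by (simp add: homset_def)
          show ?thesis
            using eq act_cmp[OF F arr_homset[OF f] k' a] act_cmp[OF F arr_homset[OF f] k' b] k by simp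
        qed
        \<comment> \<open>\<open>a\<close> and \<open>b\<close> both amalgamate the family of
          restrictions of \<open>a\<close>, so uniqueness identifies them.\<close>
        moreover have "\<exists>!y. y \<in> fob F (src C f) \<and> (\<forall>h\<in>cosieve_of C f. act F h y = act F h a)"
        proof (rule ex)
          fix h assume h: "h \<in> cosieve_of C f"
          show "act F h a \<in> fob F (tgt C h)" using act_mem[OF F hs[OF h] a] .
          fix g assume "g \<in> arr C" "src C g = tgt C h"
          then have "g \<in> homset C (tgt C h) (tgt C g)" by (simp add: homset_def)
          from act_cmp[OF F hs[OF h] this a]
          show "act F g (act F h a) = act F (g \<cdot>\<^bsub>C\<^esub> h) a" by simp
        qed
        ultimately show "a = b" using a b by metis
      qed
      fix e assume e: "self_matching C F f e"
      \<comment> \<open>The family to be glued takes the value \<open>act F k e\<close> at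
        \<open>k \<cdot> f\<close>; \<open>SOME\<close> selects a factor \<open>k\<close>, and
        self-matching shows that the value does not depend on the selection.\<close>
      define x where "x h = act F (SOME k. k \<in> arr C \<and> src C k = tgt C f \<and> h = k \<cdot>\<^bsub>C\<^esub> f) e" for h
      have x: "x (k \<cdot>\<^bsub>C\<^esub> f) = act F k e" if k: "k \<in> arr C" "src C k = tgt C f" for k
      proof -
        define k' where "k' = (SOME k'. k' \<in> arr C \<and> src C k' = tgt C f \<and> k \<cdot>\<^bsub>C\<^esub> f = k' \<cdot>\<^bsub>C\<^esub> f)"
        have k': "k' \<in> arr C \<and> src C k' = tgt C f \<and> k \<cdot>\<^bsub>C\<^esub> f = k' \<cdot>\<^bsub>C\<^esub> f"
          unfolding k'_def by (rule someI[of _ k]) (simp add: k)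
        then have "tgt C k' = tgt C k" using k f cmp_arr(3)[of f k] cmp_arr(3)[of f k'] by simp
        then have "k \<in> homset C (tgt C f) (tgt C k)" "k' \<in> homset C (tgt C f) (tgt C k)"
          using k k' by (auto simp: homset_def)
        then have "act F k e = act F k' e" using e k' unfolding self_matching_def by blast
        then show ?thesis by (simp add: x_def k'_def)
      qed
      have e': "e \<in> fob F (tgt C f)" using e by (simp add: self_matching_def)
      have "\<exists>!y. y \<in> fob F (src C f) \<and> (\<forall>h\<in>cosieve_of C f. act F h y = x h)"
      proof (rule ex)
        fix h assume "h \<in> cosieve_of C f"
        then obtain k where k: "k \<in> arr C" "src C k = tgt C f" "h = k \<cdot>\<^bsub>C\<^esub> f"
          by (auto simp: cosieve_of_def)
        have kh: "k \<in> homset C (tgt C f) (tgt C h)" using k f by (simp add: homset_def cmp_arr)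
        show "x h \<in> fob F (tgt C h)" using x[OF k(1,2)] k(3) act_mem[OF F kh e'] by simp
        fix g assume g: "g \<in> arr C" "src C g = tgt C h"
        then have gh: "g \<in> homset C (tgt C h) (tgt C g)" by (simp add: homset_def)
        have "x (g \<cdot>\<^bsub>C\<^esub> h) = x ((g \<cdot>\<^bsub>C\<^esub> k) \<cdot>\<^bsub>C\<^esub> f)" using k g f by (simp add: assoc_arr cmp_arr)
        also have "\<dots> = act F (g \<cdot>\<^bsub>C\<^esub> k) e" using k g f by (intro x) (simp_all add: cmp_arr)
        also have "\<dots> = act F g (act F k e)" using act_cmp[OF F kh gh e'] .
        also have "\<dots> = act F g (x h)" using x[OF k(1,2)] k(3) by simp
        finally show "act F g (x h) = x (g \<cdot>\<^bsub>C\<^esub> h)" by simp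
      qed
      then obtain y where y: "y \<in> fob F (src C f)" "act F f y = x f" using S(2) by blast
      \<comment> \<open>The identity as factor shows that the family has the value \<open>e\<close>
        at \<open>f\<close> itself.\<close>
      have "x f = e"
        using x[of "ident C (tgt C f)"] ident_arr[OF tgt_obj[OF f]] f
          act_ident[OF F tgt_obj[OF f] e'] by (simp add: ident_cmp_arr)
      then show "e \<in> act F f ` fob F (src C f)" using y by (intro image_eqI[of _ _ y]) simp_all
    qed
    with F show "is_functor C set_cat F \<and> ?R" by blast
  next
    assume "is_functor C set_cat F \<and> ?R"
    then have F: "is_functor C set_cat F"
      and inj: "\<And>f. f \<in> arr C \<Longrightarrow> inj_on (act F f) (fob F (src C f))"
      and glue: "\<And>f e. f \<in> arr C \<Longrightarrow> self_matching C F f e \<Longrightarrow> e \<in> act F f ` fob F (src C f)"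
      by blast+
    have "\<exists>!y. y \<in> fob F c \<and> (\<forall>f\<in>S. act F f y = x f)"
      if c: "c \<in> obj C" and S: "sieve (opcat C) c S" "S \<noteq> {}"
        and x: "\<And>f. f \<in> S \<Longrightarrow> x f \<in> fob F (tgt C f)"
        and m: "\<And>f g. f \<in> S \<Longrightarrow> g \<in> arr C \<Longrightarrow> src C g = tgt C f \<Longrightarrow> act F g (x f) = x (g \<cdot>\<^bsub>C\<^esub> f)"
      for c S x
    proof -
      obtain f where f: "f \<in> S" using S(2) by blast
      have arrS: "g \<in> arr C" "src C g = c" if "g \<in> S" for g using S(1) that by (auto simp: sieve_opcat)
      \<comment> \<open>If two composites with \<open>f\<close> coincide, they are the same member
        of \<open>S\<close>, at which the family has one value.\<close>
      have "self_matching C F f (x f)"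
        unfolding self_matching_def
      proof (intro conjI allI ballI impI)
        fix X \<alpha> \<beta> assume "\<alpha> \<in> homset C (tgt C f) X" "\<beta> \<in> homset C (tgt C f) X" "\<alpha> \<cdot>\<^bsub>C\<^esub> f = \<beta> \<cdot>\<^bsub>C\<^esub> f"
        then show "act F \<alpha> (x f) = act F \<beta> (x f)" using m[OF f, of \<alpha>] m[OF f, of \<beta>]
          by (simp add: homset_def)
      qed (rule x[OF f])
      then have "x f \<in> act F f ` fob F c" using glue[OF arrS(1)[OF f], of "x f"] arrS(2)[OF f] by simp
      then obtain y where y: "y \<in> fob F c" "act F f y = x f" by auto
      have "act F g y = x g" if g: "g \<in> S" for g
      proof -
        have "src C f = src C g" using arrS f g by simp
        \<comment> \<open>The value at another member \<open>g\<close> is tested after the leg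
          \<open>k\<close> of a cocone, where it can be computed along \<open>f\<close>; injectivity
          of the action of \<open>k\<close> removes the leg.\<close>
        then obtain h k where hk: "h \<in> arr C" "k \<in> arr C" "src C h = tgt C f" "src C k = tgt C g"
            "h \<cdot>\<^bsub>C\<^esub> f = k \<cdot>\<^bsub>C\<^esub> g"
          using ore arrS(1)[OF f] arrS(1)[OF g] unfolding spans_have_cocones_def by metis
        have fh: "f \<in> homset C c (tgt C f)" "g \<in> homset C c (tgt C g)"
          "h \<in> homset C (tgt C f) (tgt C h)" "k \<in> homset C (tgt C g) (tgt C k)"
          using arrS f g hk by (auto simp: homset_def)
        have "act F k (act F g y) = act F (k \<cdot>\<^bsub>C\<^esub> g) y" using act_cmp[OF F fh(2,4) y(1)] by simp
        also have "\<dots> = act F h (act F f y)" using act_cmp[OF F fh(1,3) y(1)] hk(5) by simp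
        also have "\<dots> = x (h \<cdot>\<^bsub>C\<^esub> f)" using y(2) m[OF f hk(1,3)] by simp
        also have "\<dots> = act F k (x g)" using m[OF g hk(2,4)] hk(5) by simp
        finally have "act F k (act F g y) = act F k (x g)" .
        moreover have "act F g y \<in> fob F (src C k)" using act_mem[OF F fh(2) y(1)] hk(4) by simp
        moreover have "x g \<in> fob F (src C k)" using x[OF g] hk(4) by simp
        ultimately show ?thesis using inj[OF hk(2)] by (blast dest: inj_onD)
      qed
      moreover have "y' = y" if "y' \<in> fob F c" "\<forall>f\<in>S. act F f y' = x f" for y'
        using inj_onD[OF inj[OF arrS(1)[OF f]], of y' y] arrS(2)[OF f] that y f by simp
      ultimately show ?thesis using y(1) by blast
    qed
    with F show ?L unfolding sheaf by blast
  qed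
qed

section \<open>Quotients by groups of natural automorphisms\<close>

lemma is_common_coequalizerD:
  assumes "is_common_coequalizer C n G Q q"
  shows "q \<in> homset C n Q" "\<And>g h. g \<in> G \<Longrightarrow> h \<in> G \<Longrightarrow> q \<cdot>\<^bsub>C\<^esub> g = q \<cdot>\<^bsub>C\<^esub> h"
    "\<And>Z z. Z \<in> obj C \<Longrightarrow> z \<in> homset C n Z \<Longrightarrow>
      (\<And>g h. g \<in> G \<Longrightarrow> h \<in> G \<Longrightarrow> z \<cdot>\<^bsub>C\<^esub> g = z \<cdot>\<^bsub>C\<^esub> h) \<Longrightarrow>
      \<exists>!k. k \<in> homset C Q Z \<and> k \<cdot>\<^bsub>C\<^esub> q = z"
  using assms unfolding is_common_coequalizer_def by blast+

text \<open>The group laws are phrased by composition of natural transformations; elementwise they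
  make the orbits an equivalence relation, with \<open>inv_mem\<close> giving symmetry.\<close>

locale nat_action = category C for C :: "('o, 'a) cat" (structure) +
  fixes n :: "('o, 'a, 's) setftor" and G :: "('o, 'a, 's) setnat set"
  assumes ftor: "is_functor C set_cat n"
    and endo: "\<sigma> \<in> G \<Longrightarrow> \<sigma> \<in> homset (functor_cat C set_cat) n n"
    and id_mem: "ident (functor_cat C set_cat) n \<in> G"
    and cmp_mem: "\<sigma> \<in> G \<Longrightarrow> \<tau> \<in> G \<Longrightarrow> \<sigma> \<cdot>\<^bsub>functor_cat C set_cat\<^esub> \<tau> \<in> G"
    and inv_mem: "\<sigma> \<in> G \<Longrightarrow>
      \<exists>\<tau>\<in>G. \<tau> \<cdot>\<^bsub>functor_cat C set_cat\<^esub> \<sigma> = ident (functor_cat C set_cat) n"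
begin

abbreviation "Psh \<equiv> functor_cat C (set_cat :: ('s set, 's setarr) cat)"

section \<open>Orbits and the pointwise quotient\<close>

definition orbit :: "'o \<Rightarrow> 's \<Rightarrow> 's \<Rightarrow> bool" where
  "orbit x e e' \<longleftrightarrow> (\<exists>\<sigma>\<in>G. e' = app \<sigma> x e)"

lemma orbit_mem: "orbit x e e' \<Longrightarrow> x \<in> obj C \<Longrightarrow> e \<in> fob n x \<Longrightarrow> e' \<in> fob n x"
  using app_mem endo by (fastforce simp: orbit_def)

lemma orbit_refl: "x \<in> obj C \<Longrightarrow> e \<in> fob n x \<Longrightarrow> orbit x e e"
  using id_mem app_ident[of x C e n] by (force simp: orbit_def)

lemma orbit_sym:
  assumes "x \<in> obj C" "e \<in> fob n x" "orbit x e e'"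
  shows "orbit x e' e"
proof -
  obtain \<sigma> where \<sigma>: "\<sigma> \<in> G" "e' = app \<sigma> x e" using assms by (auto simp: orbit_def)
  obtain \<tau> where \<tau>: "\<tau> \<in> G" "\<tau> \<cdot>\<^bsub>Psh\<^esub> \<sigma> = ident Psh n" using inv_mem[OF \<sigma>(1)] by blast
  have "app \<tau> x e' = e"
    using app_cmp[OF endo[OF \<sigma>(1)] assms(1,2), of \<tau>] \<tau>(2) app_ident[of x C e n] \<sigma>(2) assms by simp
  then show ?thesis using \<tau>(1) by (force simp: orbit_def)
qed

lemma orbit_trans:
  assumes "x \<in> obj C" "e \<in> fob n x" "orbit x e e'" "orbit x e' e''"
  shows "orbit x e e''"
proof -
  obtain \<sigma> where \<sigma>: "\<sigma> \<in> G" "e' = app \<sigma> x e" using assms by (auto simp: orbit_def)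
  obtain \<tau> where \<tau>: "\<tau> \<in> G" "e'' = app \<tau> x e'" using assms by (auto simp: orbit_def)
  show ?thesis
    using cmp_mem[OF \<tau>(1) \<sigma>(1)] app_cmp[OF endo[OF \<sigma>(1)] assms(1,2), of \<tau>] \<sigma>(2) \<tau>(2)
    by (force simp: orbit_def)
qed

lemma orbit_act:
  assumes "f \<in> homset C x y" "e \<in> fob n x" "orbit x e e'"
  shows "orbit y (act n f e) (act n f e')"
proof -
  obtain \<sigma> where \<sigma>: "\<sigma> \<in> G" "e' = app \<sigma> x e" using assms by (auto simp: orbit_def)
  then show ?thesis
    using app_act[OF category_axioms endo[OF \<sigma>(1)] assms(1,2)] by (force simp: orbit_def)
qed

text \<open>A quotient must again consist of elements of the universe, so classes are encoded by
  chosen members. The choice sees only the predicate \<open>orbit x e\<close>, hence is constant on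
  an orbit.\<close>

definition pick :: "'o \<Rightarrow> 's \<Rightarrow> 's" where
  "pick x e = (SOME e'. orbit x e e')"

lemma orbit_pick: "x \<in> obj C \<Longrightarrow> e \<in> fob n x \<Longrightarrow> orbit x e (pick x e)"
  unfolding pick_def by (rule someI) (rule orbit_refl)

lemma pick_mem: "x \<in> obj C \<Longrightarrow> e \<in> fob n x \<Longrightarrow> pick x e \<in> fob n x"
  using orbit_pick orbit_mem by blast

lemma pick_eq_iff:
  assumes "x \<in> obj C" "e \<in> fob n x" "e' \<in> fob n x"
  shows "pick x e = pick x e' \<longleftrightarrow> orbit x e e'"
proof
  assume "pick x e = pick x e'"
  then show "orbit x e e'"
    using orbit_pick[OF assms(1,2)] orbit_sym[OF assms(1,3) orbit_pick[OF assms(1,3)]]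
      orbit_trans[OF assms(1,2)] by simp
next
  assume o: "orbit x e e'"
  have "orbit x e = orbit x e'"
    using orbit_trans[OF assms(1,2) o] orbit_trans[OF assms(1,3) orbit_sym[OF assms(1,2) o]] by blast
  then show "pick x e = pick x e'" by (simp add: pick_def)
qed

text \<open>Acting on a representative need not yield a representative, hence the outer
  \<open>pick\<close> in the action.\<close>

definition quot :: "('o, 'a, 's) setftor" where
  "quot = set_ftor C (\<lambda>x. pick x ` fob n x) (\<lambda>f e. pick (tgt C f) (act n f e))"

definition quot_map :: "('o, 'a, 's) setnat" where
  "quot_map = nat_of C n quot pick"

lemma pick_act_pick:
  assumes "f \<in> homset C x y" "e \<in> fob n x"
  shows "pick y (act n f (pick x e)) = pick y (act n f e)"
proof -
  note x = homset_obj[OF assms(1)]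
  have "orbit y (act n f (pick x e)) (act n f e)"
    using orbit_act[OF assms(1) pick_mem[OF x(1) assms(2)]]
      orbit_sym[OF x(1) assms(2) orbit_pick[OF x(1) assms(2)]] by blast
  then show ?thesis
    using pick_eq_iff[OF x(2)] act_mem[OF ftor assms(1)] pick_mem[OF x(1) assms(2)] assms(2) by simp
qed

lemma functor_quot: "is_functor C set_cat quot"
  unfolding quot_def
proof (rule is_functor_set_ftor[OF category_axioms])
  fix f e assume f: "f \<in> arr C" and "e \<in> pick (src C f) ` fob n (src C f)"
  then obtain d where d: "d \<in> fob n (src C f)" "e = pick (src C f) d" by blast
  then show "pick (tgt C f) (act n f e) \<in> pick (tgt C f) ` fob n (tgt C f)"
    using act_mem[OF ftor arr_homset[OF f]] pick_mem[OF src_obj[OF f]] by simp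
  fix g assume g: "g \<in> arr C" "src C g = tgt C f"
  then have gh: "g \<in> homset C (tgt C f) (tgt C g)" by (simp add: homset_def)
  have e: "e \<in> fob n (src C f)" using d pick_mem[OF src_obj[OF f]] by simp
  show "pick (tgt C (g \<cdot> f)) (act n (g \<cdot> f) e) = pick (tgt C g) (act n g (pick (tgt C f) (act n f e)))"
    using pick_act_pick[OF gh act_mem[OF ftor arr_homset[OF f] e]]
      act_cmp[OF ftor arr_homset[OF f] gh e] f g by (simp add: cmp_arr)
next
  fix x e assume x: "x \<in> obj C" and "e \<in> pick x ` fob n x"
  then obtain d where d: "d \<in> fob n x" "e = pick x d" by blast
  have "pick x (pick x d) = pick x d"
    using pick_eq_iff[OF x pick_mem[OF x d(1)] d(1)] orbit_sym[OF x d(1) orbit_pick[OF x d(1)]] by blast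
  then show "pick (tgt C (ident C x)) (act n (ident C x) e) = e"
    using d pick_mem[OF x] ident_arr[OF x] act_ident[OF ftor x] by simp
qed

lemma fob_quot: "x \<in> obj C \<Longrightarrow> fob quot x = pick x ` fob n x"
  by (simp add: quot_def)

lemma act_quot:
  assumes "f \<in> homset C x y" "e \<in> fob n x"
  shows "act quot f (pick x e) = pick y (act n f e)"
proof -
  have "act quot f (pick x e) = pick y (act n f (pick x e))"
    using homsetD[OF assms(1)] assms(2) by (simp add: quot_def)
  then show ?thesis using pick_act_pick[OF assms] by simp
qed

lemma quot_map_hom: "quot_map \<in> homset Psh n quot"
  unfolding quot_map_def
  by (rule nat_of_hom[OF category_axioms ftor functor_quot]) (simp_all add: fob_quot act_quot)

lemma app_quot_map: "x \<in> obj C \<Longrightarrow> e \<in> fob n x \<Longrightarrow> app quot_map x e = pick x e"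
  by (simp add: quot_map_def)

text \<open>The identity lies in \<open>G\<close>, so equalizing all of \<open>G\<close> amounts to
  invariance under each single member, that is, along orbits.\<close>

lemma coequalizing_iff:
  assumes z: "z \<in> homset Psh n Z"
  shows "(\<forall>g\<in>G. \<forall>h\<in>G. z \<cdot>\<^bsub>Psh\<^esub> g = z \<cdot>\<^bsub>Psh\<^esub> h) \<longleftrightarrow>
    (\<forall>x\<in>obj C. \<forall>e\<in>fob n x. \<forall>e'. orbit x e e' \<longrightarrow> app z x e = app z x e')"
proof
  interpret P: category Psh by (rule category_functor_cat[OF category_axioms])
  assume eq: "\<forall>g\<in>G. \<forall>h\<in>G. z \<cdot>\<^bsub>Psh\<^esub> g = z \<cdot>\<^bsub>Psh\<^esub> h"
  show "\<forall>x\<in>obj C. \<forall>e\<in>fob n x. \<forall>e'. orbit x e e' \<longrightarrow> app z x e = app z x e'"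
  proof (intro ballI allI impI)
    fix x e e' assume x: "x \<in> obj C" and e: "e \<in> fob n x" and "orbit x e e'"
    then obtain \<sigma> where \<sigma>: "\<sigma> \<in> G" "e' = app \<sigma> x e" by (auto simp: orbit_def)
    have "z \<cdot>\<^bsub>Psh\<^esub> \<sigma> = z \<cdot>\<^bsub>Psh\<^esub> ident Psh n" using eq \<sigma>(1) id_mem by blast
    then have "app (z \<cdot>\<^bsub>Psh\<^esub> \<sigma>) x e = app z x e" using P.cmp_ident_right[OF z] by simp
    then show "app z x e = app z x e'" using app_cmp[OF endo[OF \<sigma>(1)] x e, of z] \<sigma>(2) by simp
  qed
next
  interpret P: category Psh by (rule category_functor_cat[OF category_axioms])
  assume eq: "\<forall>x\<in>obj C. \<forall>e\<in>fob n x. \<forall>e'. orbit x e e' \<longrightarrow> app z x e = app z x e'"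
  show "\<forall>g\<in>G. \<forall>h\<in>G. z \<cdot>\<^bsub>Psh\<^esub> g = z \<cdot>\<^bsub>Psh\<^esub> h"
  proof (intro ballI)
    fix g h assume g: "g \<in> G" and h: "h \<in> G"
    show "z \<cdot>\<^bsub>Psh\<^esub> g = z \<cdot>\<^bsub>Psh\<^esub> h"
    proof (rule nat_eqI[OF P.cmp_hom[OF endo[OF g] z] P.cmp_hom[OF endo[OF h] z]])
      fix x e assume x: "x \<in> obj C" and e: "e \<in> fob n x"
      have "orbit x e (app g x e)" "orbit x e (app h x e)" using g h by (auto simp: orbit_def)
      then have "app z x (app g x e) = app z x (app h x e)" using eq x e by metis
      then show "app (z \<cdot>\<^bsub>Psh\<^esub> g) x e = app (z \<cdot>\<^bsub>Psh\<^esub> h) x e"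
        using app_cmp[OF endo[OF g] x e] app_cmp[OF endo[OF h] x e] by simp
    qed
  qed
qed

lemma quot_coequalizer: "is_common_coequalizer Psh n G quot quot_map"
  unfolding is_common_coequalizer_def
proof (intro conjI)
  interpret P: category Psh by (rule category_functor_cat[OF category_axioms])
  show "\<forall>g\<in>G. \<forall>h\<in>G. quot_map \<cdot>\<^bsub>Psh\<^esub> g = quot_map \<cdot>\<^bsub>Psh\<^esub> h"
    unfolding coequalizing_iff[OF quot_map_hom]
    using pick_eq_iff orbit_mem by (simp add: app_quot_map)
  show "\<forall>Z\<in>obj Psh. \<forall>z\<in>homset Psh n Z. (\<forall>g\<in>G. \<forall>h\<in>G. z \<cdot>\<^bsub>Psh\<^esub> g = z \<cdot>\<^bsub>Psh\<^esub> h) \<longrightarrow>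
        (\<exists>!k. k \<in> homset Psh quot Z \<and> k \<cdot>\<^bsub>Psh\<^esub> quot_map = z)"
  proof (intro ballI impI)
    fix Z z assume z: "z \<in> homset Psh n Z" and "\<forall>g\<in>G. \<forall>h\<in>G. z \<cdot>\<^bsub>Psh\<^esub> g = z \<cdot>\<^bsub>Psh\<^esub> h"
    then have inv: "app z x (pick x e) = app z x e" if "x \<in> obj C" "e \<in> fob n x" for x e
      using coequalizing_iff[OF z] orbit_pick that by metis
    \<comment> \<open>\<open>z\<close> is constant on orbits, so its values at the chosen members
      already define the factorization.\<close>
    define k where "k = nat_of C quot Z (app z)"
    have k: "k \<in> homset Psh quot Z"
      unfolding k_def
    proof (rule nat_of_hom[OF category_axioms functor_quot nat_functors(2)[OF z]])
      fix x e assume "x \<in> obj C" "e \<in> fob quot x"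
      then show "app z x e \<in> fob Z x" using inv app_mem[OF z] by (auto simp: fob_quot)
    next
      fix x y f e assume f: "f \<in> homset C x y" and "e \<in> fob quot x"
      then obtain d where d: "d \<in> fob n x" "e = pick x d" using homset_obj by (auto simp: fob_quot)
      then show "app z y (act quot f e) = act Z f (app z x e)"
        using f homset_obj[OF f] act_mem[OF ftor f d(1)]
        by (simp add: act_quot inv app_act[OF category_axioms z f])
    qed
    have app_k: "app k x (pick x e) = app z x e" if "x \<in> obj C" "e \<in> fob n x" for x e
      using that inv by (simp add: k_def fob_quot)
    show "\<exists>!k. k \<in> homset Psh quot Z \<and> k \<cdot>\<^bsub>Psh\<^esub> quot_map = z"
    proof (rule ex1I[of _ k])
      have "k \<cdot>\<^bsub>Psh\<^esub> quot_map = z"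
        by (rule nat_eqI[OF P.cmp_hom[OF quot_map_hom k] z])
          (simp add: app_cmp[OF quot_map_hom] app_quot_map app_k)
      with k show "k \<in> homset Psh quot Z \<and> k \<cdot>\<^bsub>Psh\<^esub> quot_map = z" by blast
      fix k' assume k': "k' \<in> homset Psh quot Z \<and> k' \<cdot>\<^bsub>Psh\<^esub> quot_map = z"
      show "k' = k"
      proof (rule nat_eqI[OF conjunct1[OF k'] k])
        fix x e assume x: "x \<in> obj C" and "e \<in> fob quot x"
        then obtain d where d: "d \<in> fob n x" "e = pick x d" by (auto simp: fob_quot)
        have "app (k' \<cdot>\<^bsub>Psh\<^esub> quot_map) x d = app z x d" using k' by simp
        then show "app k' x e = app k x e"
          using d x app_k by (simp add: app_cmp[OF quot_map_hom] app_quot_map)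
      qed
    qed
  qed
qed (rule quot_map_hom)

text \<open>Universality determines a coequalizer up to isomorphism, so fibres and surjectivity of
  an arbitrary one can be read off the explicit \<open>quot\<close> through the comparison maps
  \<open>k\<close> and \<open>l\<close>.\<close>

lemma coequalizer_elementwise:
  assumes Q: "is_common_coequalizer Psh n G Q q" and x: "x \<in> obj C"
  shows "e \<in> fob n x \<Longrightarrow> e' \<in> fob n x \<Longrightarrow> app q x e = app q x e' \<longleftrightarrow> orbit x e e'"
    and "fob Q x = app q x ` fob n x"
proof -
  interpret P: category Psh by (rule category_functor_cat[OF category_axioms])
  note q = is_common_coequalizerD[OF Q] and q0 = is_common_coequalizerD[OF quot_coequalizer]
  have obj: "Q \<in> obj Psh" "quot \<in> obj Psh" using nat_functors(2)[OF q(1)] functor_quot by simp_all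
  obtain k where k: "k \<in> homset Psh Q quot" "k \<cdot>\<^bsub>Psh\<^esub> q = quot_map"
    using q(3)[OF obj(2) q0(1) q0(2)] by blast
  obtain l where l: "l \<in> homset Psh quot Q" "l \<cdot>\<^bsub>Psh\<^esub> quot_map = q"
    using q0(3)[OF obj(1) q(1) q(2)] by blast
  have app_k: "app k x (app q x e) = pick x e" if "e \<in> fob n x" for e
    using app_cmp[OF q(1) x that, of k] k(2) app_quot_map[OF x that] by simp
  have app_l: "app l x (pick x e) = app q x e" if "e \<in> fob n x" for e
    using app_cmp[OF quot_map_hom x that, of l] l(2) app_quot_map[OF x that] by simp
  show "app q x e = app q x e' \<longleftrightarrow> orbit x e e'" if "e \<in> fob n x" "e' \<in> fob n x"
    using pick_eq_iff[OF x that] app_k app_l that by metis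
  \<comment> \<open>Both \<open>l\<close> after \<open>k\<close> and the identity fix
    \<open>q\<close>; uniqueness identifies them, which makes \<open>q\<close> surjective at
    \<open>x\<close>.\<close>
  have "\<exists>!h. h \<in> homset Psh Q Q \<and> h \<cdot>\<^bsub>Psh\<^esub> q = q"
    using q(3)[OF obj(1) q(1) q(2)] .
  moreover have "(l \<cdot>\<^bsub>Psh\<^esub> k) \<cdot>\<^bsub>Psh\<^esub> q = q" using P.cmp_assoc[OF q(1) k(1) l(1)] k(2) l(2) by simp
  moreover have "ident Psh Q \<cdot>\<^bsub>Psh\<^esub> q = q" by (rule P.cmp_ident_left[OF q(1)])
  ultimately have lk: "l \<cdot>\<^bsub>Psh\<^esub> k = ident Psh Q"
    using P.cmp_hom[OF k(1) l(1)] P.ident_hom[OF obj(1)] by blast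
  have "d \<in> app q x ` fob n x" if d: "d \<in> fob Q x" for d
  proof -
    have "app k x d \<in> pick x ` fob n x" using app_mem[OF k(1) x d] x by (simp add: fob_quot)
    then obtain e where e: "e \<in> fob n x" "app k x d = pick x e" by blast
    have "d = app l x (app k x d)" using app_cmp[OF k(1) x d, of l] lk app_ident[OF x d] by simp
    then show ?thesis using e app_l by simp
  qed
  then show "fob Q x = app q x ` fob n x" using app_mem[OF q(1) x] by auto
qed

text \<open>Lifts of \<open>a\<close> and \<open>b\<close> to \<open>n\<close> can be moved within
  orbits until they agree over \<open>?Z\<close>, where the pullback property of \<open>n\<close>
  applies. Two solutions differ by group elements \<open>\<rho>\<close> and \<open>\<tau>\<close> on
  the two legs; these agree on an element over \<open>?Z\<close>, so freeness makes them equal and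
  the solutions lie in one orbit.\<close>

lemma coequalizer_preserves_pullbacks:
  assumes Q: "is_common_coequalizer Psh n G Q q"
    and pp: "preserves_pullbacks C set_cat n"
    and free: "\<And>\<sigma> \<tau> x e. \<sigma> \<in> G \<Longrightarrow> \<tau> \<in> G \<Longrightarrow> x \<in> obj C \<Longrightarrow> e \<in> fob n x \<Longrightarrow>
      app \<sigma> x e = app \<tau> x e \<Longrightarrow> \<sigma> = \<tau>"
  shows "is_functor C set_cat Q" "preserves_pullbacks C set_cat Q"
proof -
  note q = is_common_coequalizerD(1)[OF Q]
  show FQ: "is_functor C set_cat Q" using nat_functors(2)[OF q] .
  have "\<exists>!e. e \<in> fob Q (src C p) \<and> act Q p e = a \<and> act Q r e = b"
    if pb: "is_pullback C f g p r" and a: "a \<in> fob Q (src C f)" and b: "b \<in> fob Q (src C g)"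
      and ab: "act Q f a = act Q g b" for f g p r a b
  proof -
    let ?A = "src C f" and ?B = "src C g" and ?P = "src C p" and ?Z = "tgt C f"
    have h: "f \<in> homset C ?A ?Z" "g \<in> homset C ?B ?Z" "p \<in> homset C ?P ?A" "r \<in> homset C ?P ?B"
      and comm: "f \<cdot> p = g \<cdot> r"
      using pb by (auto simp: is_pullback_def homset_def)
    note o = homset_obj(1)[OF h(1)] homset_obj(1)[OF h(2)] homset_obj(1)[OF h(3)] homset_obj(2)[OF h(1)]
    have nat: "app q y (act n k e) = act Q k (app q x e)" if "k \<in> homset C x y" "e \<in> fob n x" for k x y e
      using app_act[OF category_axioms q that] .
    note iff = coequalizer_elementwise(1)[OF Q]
    note surj = coequalizer_elementwise(2)[OF Q]
    note mem = act_mem[OF ftor]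
    obtain a' where a': "a' \<in> fob n ?A" "a = app q ?A a'" using a surj[OF o(1)] by blast
    obtain b' where b': "b' \<in> fob n ?B" "b = app q ?B b'" using b surj[OF o(2)] by blast
    have "app q ?Z (act n f a') = app q ?Z (act n g b')"
      using ab nat[OF h(1) a'(1)] nat[OF h(2) b'(1)] a' b' by simp
    then have "orbit ?Z (act n f a') (act n g b')"
      using iff[OF o(4) mem[OF h(1) a'(1)] mem[OF h(2) b'(1)]] by blast
    \<comment> \<open>The images of the lifts over \<open>?Z\<close> may differ by a group element;
      translating \<open>a'\<close> by it removes the discrepancy without changing the
      class.\<close>
    then obtain \<sigma> where \<sigma>: "\<sigma> \<in> G" "act n g b' = app \<sigma> ?Z (act n f a')" by (auto simp: orbit_def)
    have \<sigma>a: "app \<sigma> ?A a' \<in> fob n ?A" using app_mem[OF endo[OF \<sigma>(1)] o(1) a'(1)] .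
    have "act n f (app \<sigma> ?A a') = act n g b'"
      using \<sigma>(2) app_act[OF category_axioms endo[OF \<sigma>(1)] h(1) a'(1)] by simp
    then obtain e where e: "e \<in> fob n ?P" "act n p e = app \<sigma> ?A a'" "act n r e = b'"
      using preserves_pullbacksD[OF category_axioms ftor pp pb \<sigma>a b'(1)] by blast
    have "orbit ?A a' (app \<sigma> ?A a')" using \<sigma>(1) by (auto simp: orbit_def)
    then have qe: "app q ?A (act n p e) = a" "app q ?B (act n r e) = b"
      using iff[OF o(1) a'(1) \<sigma>a] e a' b' by simp_all
    show ?thesis
    proof (rule ex1I[of _ "app q ?P e"])
      show "app q ?P e \<in> fob Q ?P \<and> act Q p (app q ?P e) = a \<and> act Q r (app q ?P e) = b"
        using qe app_mem[OF q o(3) e(1)] nat[OF h(3) e(1)] nat[OF h(4) e(1)] by simp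
      fix d assume d: "d \<in> fob Q ?P \<and> act Q p d = a \<and> act Q r d = b"
      then obtain c where c: "c \<in> fob n ?P" "d = app q ?P c" using surj[OF o(3)] by blast
      have "app q ?A (act n p e) = app q ?A (act n p c)" using d c qe nat[OF h(3) c(1)] by simp
      then have "orbit ?A (act n p e) (act n p c)"
        using iff[OF o(1) mem[OF h(3) e(1)] mem[OF h(3) c(1)]] by simp
      then obtain \<rho> where \<rho>: "\<rho> \<in> G" "act n p c = app \<rho> ?A (act n p e)" by (auto simp: orbit_def)
      have "app q ?B (act n r e) = app q ?B (act n r c)" using d c qe nat[OF h(4) c(1)] by simp
      then have "orbit ?B (act n r e) (act n r c)"
        using iff[OF o(2) mem[OF h(4) e(1)] mem[OF h(4) c(1)]] by simp
      then obtain \<tau> where \<tau>: "\<tau> \<in> G" "act n r c = app \<tau> ?B (act n r e)" by (auto simp: orbit_def)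
      have fp: "act n f (act n p z) = act n g (act n r z)" if "z \<in> fob n ?P" for z
        using act_cmp[OF ftor h(3,1) that] act_cmp[OF ftor h(4,2) that] comm by simp
      \<comment> \<open>Both group elements carry the image of \<open>e\<close> over
        \<open>?Z\<close> to the image of \<open>c\<close>, computed along one leg and then along
        the other.\<close>
      have "app \<rho> ?Z (act n f (act n p e)) = act n f (act n p c)"
        using app_act[OF category_axioms endo[OF \<rho>(1)] h(1) mem[OF h(3) e(1)]] \<rho>(2) by simp
      also have "\<dots> = act n g (act n r c)" using fp[OF c(1)] .
      also have "\<dots> = app \<tau> ?Z (act n g (act n r e))"
        using app_act[OF category_axioms endo[OF \<tau>(1)] h(2) mem[OF h(4) e(1)]] \<tau>(2) by simp
      also have "\<dots> = app \<tau> ?Z (act n f (act n p e))" using fp[OF e(1)] by simp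
      finally have "\<rho> = \<tau>" by (rule free[OF \<rho>(1) \<tau>(1) o(4) mem[OF h(1) mem[OF h(3) e(1)]]])
      have \<rho>e: "app \<rho> ?P e \<in> fob n ?P" using app_mem[OF endo[OF \<rho>(1)] o(3) e(1)] .
      have "act n p (app \<rho> ?P e) = act n p c" "act n r (app \<rho> ?P e) = act n r c"
        using app_act[OF category_axioms endo[OF \<rho>(1)] h(3) e(1)]
          app_act[OF category_axioms endo[OF \<rho>(1)] h(4) e(1)] \<rho>(2) \<tau>(2) \<open>\<rho> = \<tau>\<close> by simp_all
      moreover have "\<exists>!z. z \<in> fob n ?P \<and> act n p z = act n p c \<and> act n r z = act n r c"
        using pp pb mem[OF h(3) c(1)] mem[OF h(4) c(1)] fp[OF c(1)]
        unfolding preserves_pullbacks_set_iff[OF category_axioms ftor] by blast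
      ultimately have "c = app \<rho> ?P e" using \<rho>e c(1) by blast
      then have "orbit ?P e c" using \<rho>(1) by (auto simp: orbit_def)
      then show "d = app q ?P e" using c iff[OF o(3) e(1) c(1)] by simp
    qed
  qed
  then show "preserves_pullbacks C set_cat Q"
    unfolding preserves_pullbacks_set_iff[OF category_axioms FQ] by blast
qed

end

section \<open>Representable sheaves\<close>

locale atomic_setting = category C for C :: "('o, 'a) cat" (structure) +
  fixes \<iota> :: "'a \<Rightarrow> 's"
    and L :: "(('o, 'a, 's) setftor, ('o, 'a, 's) setnat,
               ('o, 'a, 's) setftor, ('o, 'a, 's) setnat) ftor"
    and \<eta> :: "('o, 'a, 's) setftor \<Rightarrow> ('o, 'a, 's) setnat"
  assumes inj: "inj_on \<iota> (arr C)"
    and sheafification: "is_sheafification (opcat C) (atomic_topology (opcat C)) L \<eta>"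
    and ff: "fully_faithful (opcat C) (atomic_sheaf_cat (opcat C))
               (canonical_functor (opcat C) \<iota> L)"
    and atoms: "\<forall>c\<in>obj (opcat C). is_atom (atomic_sheaf_cat (opcat C))
               (fob (canonical_functor (opcat C) \<iota> L) c)"
    and pushouts: "has_pushouts (opcat C)"
    and pres_pushouts: "preserves_pushouts (opcat C) (atomic_sheaf_cat (opcat C))
               (canonical_functor (opcat C) \<iota> L)"
    and wf: "well_founded C"
begin

abbreviation "Psh \<equiv> functor_cat C (set_cat :: ('s set, 's setarr) cat)"
abbreviation "Sh \<equiv> atomic_sheaf_cat (opcat C) :: (('o, 'a, 's) setftor, ('o, 'a, 's) setnat) cat"
abbreviation sheaf :: "('o, 'a, 's) setftor \<Rightarrow> bool" where
  "sheaf F \<equiv> is_sheaf (opcat C) (atomic_topology (opcat C)) F"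
abbreviation "can \<equiv> canonical_functor (opcat C) \<iota> L"
abbreviation "hp \<equiv> hom_presheaf (opcat C) \<iota>"

text \<open>The universal element: by \<open>can_universal\<close>, maps from the representable
  sheaf of \<open>c\<close> to a sheaf are determined by where they send it, and any value is
  possible.\<close>

definition gen :: "'o \<Rightarrow> 's" where
  "gen c = app (\<eta> (hp c)) c (\<iota> (ident C c))"

lemma category_Psh: "category Psh"
  by (rule category_functor_cat[OF category_axioms])

lemma Sh_def: "Sh = full_subcat Psh {F. sheaf F}"
  by (simp add: sheaf_cat_def)

lemma category_Sh: "category Sh"
  unfolding Sh_def by (rule category_full_subcat[OF category_Psh])

lemma sheaf_functor: "sheaf F \<Longrightarrow> is_functor C set_cat F"
  by (simp add: is_sheaf_def)

lemma Sh_sel [simp]: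
  "obj Sh = {F. sheaf F}" "src Sh = tsrc" "tgt Sh = ttgt" "ident Sh = ident Psh"
  "s \<cdot>\<^bsub>Sh\<^esub> t = s \<cdot>\<^bsub>Psh\<^esub> t"
  unfolding Sh_def using sheaf_functor by auto

lemma homset_Sh: "t \<in> homset Sh F G \<longleftrightarrow> sheaf F \<and> sheaf G \<and> t \<in> homset Psh F G"
  unfolding Sh_def by (simp add: homset_full_subcat)

section \<open>Hom-presheaves and the Yoneda lemma\<close>

lemma hp_eq: "hp c = set_ftor C (\<lambda>m. \<iota> ` homset C c m) (\<lambda>f e. \<iota> (inv_into (arr C) \<iota> e \<cdot>\<^bsub>opcat C\<^esub> f))"
  by (simp add: hom_presheaf_def set_ftor_def)

lemma inv_\<iota> [simp]: "a \<in> homset C x y \<Longrightarrow> inv_into (arr C) \<iota> (\<iota> a) = a"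
  using inj by (simp add: homset_def)

lemma fob_hp: "x \<in> obj C \<Longrightarrow> fob (hp c) x = \<iota> ` homset C c x"
  by (simp add: hp_eq)

lemma act_hp: "a \<in> homset C c x \<Longrightarrow> f \<in> homset C x y \<Longrightarrow> act (hp c) f (\<iota> a) = \<iota> (f \<cdot> a)"
  using homsetD[of f C x y] by (simp add: hp_eq)

lemma functor_hp: "is_functor C set_cat (hp c)"
  unfolding hp_eq
proof (rule is_functor_set_ftor[OF category_axioms])
  fix f e assume f: "f \<in> arr C" and "e \<in> \<iota> ` homset C c (src C f)"
  then obtain a where a: "a \<in> homset C c (src C f)" "e = \<iota> a" by blast
  note fa = cmp_hom[OF a(1) arr_homset[OF f]]
  show "\<iota> (inv_into (arr C) \<iota> e \<cdot>\<^bsub>opcat C\<^esub> f) \<in> \<iota> ` homset C c (tgt C f)"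
    using a fa by simp
  fix g assume g: "g \<in> arr C" "src C g = tgt C f"
  then have gh: "g \<in> homset C (tgt C f) (tgt C g)" by (simp add: homset_def)
  show "\<iota> (inv_into (arr C) \<iota> e \<cdot>\<^bsub>opcat C\<^esub> (g \<cdot> f)) =
    \<iota> (inv_into (arr C) \<iota> (\<iota> (inv_into (arr C) \<iota> e \<cdot>\<^bsub>opcat C\<^esub> f)) \<cdot>\<^bsub>opcat C\<^esub> g)"
    using a fa cmp_assoc[OF a(1) arr_homset[OF f] gh] by simp
next
  fix x e assume "x \<in> obj C" "e \<in> \<iota> ` homset C c x"
  then show "\<iota> (inv_into (arr C) \<iota> e \<cdot>\<^bsub>opcat C\<^esub> ident C x) = e"
    by (auto simp: cmp_ident_left)
qed

text \<open>Every element \<open>\<iota> a\<close> is the image of the identity under the action of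
  \<open>a\<close>, so naturality forces its value to be the action of \<open>a\<close> on
  \<open>e\<close>.\<close>

lemma yoneda_elements:
  assumes c: "c \<in> obj C" and F: "is_functor C set_cat F" and e: "e \<in> fob F c"
  shows "\<exists>!t. t \<in> homset Psh (hp c) F \<and> app t c (\<iota> (ident C c)) = e"
proof (rule ex1I)
  let ?t = "nat_of C (hp c) F (\<lambda>x z. act F (inv_into (arr C) \<iota> z) e)"
  have id: "\<iota> (ident C c) \<in> fob (hp c) c" using ident_hom[OF c] c by (simp add: fob_hp)
  have "?t \<in> homset Psh (hp c) F"
  proof (rule nat_of_hom[OF category_axioms functor_hp F])
    fix x z assume "x \<in> obj C" "z \<in> fob (hp c) x"
    then obtain a where "a \<in> homset C c x" "z = \<iota> a" by (auto simp: fob_hp)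
    then show "act F (inv_into (arr C) \<iota> z) e \<in> fob F x" using act_mem[OF F _ e] by simp
  next
    fix x y f z assume f: "f \<in> homset C x y" and "z \<in> fob (hp c) x"
    then obtain a where a: "a \<in> homset C c x" "z = \<iota> a" using homset_obj by (auto simp: fob_hp)
    then show "act F (inv_into (arr C) \<iota> (act (hp c) f z)) e = act F f (act F (inv_into (arr C) \<iota> z) e)"
      using act_cmp[OF F a(1) f e] cmp_hom[OF a(1) f] f by (simp add: act_hp)
  qed
  moreover have "app ?t c (\<iota> (ident C c)) = e"
    using c id act_ident[OF F c e] ident_hom[OF c] by simp
  ultimately show "?t \<in> homset Psh (hp c) F \<and> app ?t c (\<iota> (ident C c)) = e" by blast
  fix t assume t: "t \<in> homset Psh (hp c) F \<and> app t c (\<iota> (ident C c)) = e"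
  have val: "app s x (\<iota> a) = act F a (app s c (\<iota> (ident C c)))"
    if "s \<in> homset Psh (hp c) F" "a \<in> homset C c x" for s x a
    using app_act[OF category_axioms that id] act_hp[OF ident_hom[OF c] that(2)] cmp_ident_right[OF that(2)]
    by simp
  show "t = ?t"
  proof (rule nat_eqI[OF conjunct1[OF t] \<open>?t \<in> homset Psh (hp c) F\<close>])
    fix x z assume "x \<in> obj C" "z \<in> fob (hp c) x"
    then obtain a where a: "a \<in> homset C c x" "z = \<iota> a" by (auto simp: fob_hp)
    show "app t x z = app ?t x z"
      unfolding a(2) val[OF conjunct1[OF t] a(1)] val[OF \<open>?t \<in> homset Psh (hp c) F\<close> a(1)]
        \<open>app ?t c (\<iota> (ident C c)) = e\<close> conjunct2[OF t] ..
  qed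
qed

section \<open>The universal property of representable sheaves\<close>

lemmas sheafification_conjs = sheafification[unfolded is_sheafification_def opcat_opcat]

lemma sheafification_functor: "is_functor Psh Sh L"
  by (rule conjunct1[OF sheafification_conjs])

lemma functor_far_homset:
  "is_functor A B F \<Longrightarrow> f \<in> arr A \<Longrightarrow> far F f \<in> homset B (fob F (src A f)) (fob F (tgt A f))"
  unfolding is_functor_def by blast

lemma unit_hom: "is_functor C set_cat P \<Longrightarrow> \<eta> P \<in> homset Psh P (fob L P)"
  by (rule bspec[OF conjunct1[OF conjunct2[OF sheafification_conjs]]]) simp

lemma unit_natural:
  "t \<in> arr Psh \<Longrightarrow> \<eta> (ttgt t) \<cdot>\<^bsub>Psh\<^esub> t = far L t \<cdot>\<^bsub>Psh\<^esub> \<eta> (tsrc t)"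
  by (rule bspec[OF conjunct1[OF conjunct2[OF conjunct2[OF sheafification_conjs]]]])

lemma sheafification_universal:
  assumes P: "is_functor C set_cat P" and F: "sheaf F" and h: "h \<in> homset Psh P F"
  shows "\<exists>!k. k \<in> homset Sh (fob L P) F \<and> k \<cdot>\<^bsub>Psh\<^esub> \<eta> P = h"
proof -
  have "P \<in> obj Psh" "F \<in> obj Sh" using P F by simp_all
  with conjunct2[OF conjunct2[OF conjunct2[OF sheafification_conjs]]] h show ?thesis by blast
qed

lemma fob_can: "c \<in> obj C \<Longrightarrow> fob can c = fob L (hp c)"
  by (simp add: canonical_functor_def fcompose_def yoneda_def compose_def)

lemma sheaf_can: "c \<in> obj C \<Longrightarrow> sheaf (fob can c)"
proof -
  assume c: "c \<in> obj C"
  have "fob L \<in> obj Psh \<rightarrow>\<^sub>E obj Sh" 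
    by (rule conjunct1[OF sheafification_functor[unfolded is_functor_def]])
  then have "fob L (hp c) \<in> obj Sh" by (rule PiE_mem) (simp add: functor_hp)
  then show "sheaf (fob can c)" using c by (simp add: fob_can)
qed

lemma functor_can: "c \<in> obj C \<Longrightarrow> is_functor C set_cat (fob can c)"
  using sheaf_can sheaf_functor by blast

lemma id_mem_hp: "c \<in> obj C \<Longrightarrow> \<iota> (ident C c) \<in> fob (hp c) c"
  using ident_hom by (simp add: fob_hp)

lemma gen_mem: "c \<in> obj C \<Longrightarrow> gen c \<in> fob (fob can c) c"
  using app_mem[OF unit_hom[OF functor_hp] _ id_mem_hp] by (simp add: gen_def fob_can)

text \<open>Precomposition with the unit turns maps of sheaves into maps out of the hom-presheaf,
  and the Yoneda lemma turns these into elements.\<close>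

lemma can_universal:
  assumes c: "c \<in> obj C" and F: "sheaf F" and e: "e \<in> fob F c"
  shows "\<exists>!t. t \<in> homset Sh (fob can c) F \<and> app t c (gen c) = e"
proof -
  interpret P: category Psh by (rule category_Psh)
  note \<eta> = unit_hom[OF functor_hp, of c]
  have val: "app (k \<cdot>\<^bsub>Psh\<^esub> \<eta> (hp c)) c (\<iota> (ident C c)) = app k c (gen c)" for k
    using app_cmp[OF \<eta> c id_mem_hp[OF c]] by (simp add: gen_def)
  obtain h where h: "h \<in> homset Psh (hp c) F" "app h c (\<iota> (ident C c)) = e"
    and h_unique: "\<And>h'. h' \<in> homset Psh (hp c) F \<Longrightarrow> app h' c (\<iota> (ident C c)) = e \<Longrightarrow> h' = h"
    using yoneda_elements[OF c sheaf_functor[OF F] e] by blast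
  obtain k where k: "k \<in> homset Sh (fob L (hp c)) F" "k \<cdot>\<^bsub>Psh\<^esub> \<eta> (hp c) = h"
    and k_unique: "\<And>k'. k' \<in> homset Sh (fob L (hp c)) F \<Longrightarrow> k' \<cdot>\<^bsub>Psh\<^esub> \<eta> (hp c) = h \<Longrightarrow> k' = k"
    using sheafification_universal[OF functor_hp F h(1)] by blast
  show ?thesis
  proof (rule ex1I[of _ k])
    show "k \<in> homset Sh (fob can c) F \<and> app k c (gen c) = e"
      using k h(2) val[of k] by (simp add: fob_can[OF c])
    fix k' assume k': "k' \<in> homset Sh (fob can c) F \<and> app k' c (gen c) = e"
    then have "k' \<cdot>\<^bsub>Psh\<^esub> \<eta> (hp c) \<in> homset Psh (hp c) F"
      using P.cmp_hom[OF \<eta>] by (simp add: homset_Sh fob_can[OF c])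
    then have "k' \<cdot>\<^bsub>Psh\<^esub> \<eta> (hp c) = h" using h_unique val[of k'] k' by simp
    then show "k' = k" using k_unique k' by (simp add: fob_can[OF c])
  qed
qed

lemma can_eqI:
  assumes "c \<in> obj C" "s \<in> homset Sh (fob can c) F" "t \<in> homset Sh (fob can c) F"
    and "app s c (gen c) = app t c (gen c)"
  shows "s = t"
proof -
  have "sheaf F" "s \<in> homset Psh (fob can c) F" using assms(2) by (simp_all add: homset_Sh)
  then have "\<exists>!t'. t' \<in> homset Sh (fob can c) F \<and> app t' c (gen c) = app s c (gen c)"
    using assms(1) app_mem[OF _ assms(1) gen_mem[OF assms(1)]] by (intro can_universal)
  then show ?thesis using assms by metis
qed

section \<open>The canonical functor on arrows\<close>

lemma far_yoneda:
  assumes a: "a \<in> homset C c x"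
  shows "far (yoneda (opcat C) \<iota>) a \<in> homset Psh (hp x) (hp c)"
    and "app (far (yoneda (opcat C) \<iota>) a) x (\<iota> (ident C x)) = \<iota> a"
proof -
  note o = homset_obj[OF a]
  have far: "far (yoneda (opcat C) \<iota>) a = nat_of C (hp x) (hp c) (\<lambda>m e. \<iota> (inv_into (arr C) \<iota> e \<cdot> a))"
    using homsetD[OF a] by (auto simp: yoneda_def nat_of_def fob_hp intro!: restrict_ext)
  show "far (yoneda (opcat C) \<iota>) a \<in> homset Psh (hp x) (hp c)"
    unfolding far
  proof (rule nat_of_hom[OF category_axioms functor_hp functor_hp])
    fix m e assume "m \<in> obj C" "e \<in> fob (hp x) m"
    then show "\<iota> (inv_into (arr C) \<iota> e \<cdot> a) \<in> fob (hp c) m"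
      using cmp_hom[OF a] by (auto simp: fob_hp)
  next
    fix m m' f e assume f: "f \<in> homset C m m'" and "e \<in> fob (hp x) m"
    then obtain b where b: "b \<in> homset C x m" "e = \<iota> b" using homset_obj by (auto simp: fob_hp)
    have "\<iota> ((f \<cdot> b) \<cdot> a) = \<iota> (f \<cdot> (b \<cdot> a))" using cmp_assoc[OF a b(1) f] by simp
    then show "\<iota> (inv_into (arr C) \<iota> (act (hp x) f e) \<cdot> a) = act (hp c) f (\<iota> (inv_into (arr C) \<iota> e \<cdot> a))"
      using b f cmp_hom[OF b(1) f] cmp_hom[OF a b(1)] by (simp add: act_hp)
  qed
  show "app (far (yoneda (opcat C) \<iota>) a) x (\<iota> (ident C x)) = \<iota> a"
    unfolding far using o id_mem_hp ident_hom[OF o(2)] cmp_ident_left[OF a] by simp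
qed

text \<open>Naturality of the unit transfers the claim to hom-presheaves, where precomposing the
  identity of \<open>x\<close> with \<open>a\<close> and acting by \<open>a\<close> on the identity
  of \<open>c\<close> both give \<open>a\<close>. Arrows of \<open>C\<close> are reversed because
  the functor starts from the opposite category.\<close>

lemma far_can:
  assumes a: "a \<in> homset C c x"
  shows "far can a \<in> homset Sh (fob can x) (fob can c)"
    and "app (far can a) x (gen x) = act (fob can c) a (gen c)"
proof -
  note o = homset_obj[OF a]
  let ?t = "far (yoneda (opcat C) \<iota>) a"
  note t = far_yoneda[OF a]
  have far: "far can a = far L ?t"
    using homsetD[OF a] by (simp add: canonical_functor_def fcompose_def compose_def)
  have "?t \<in> arr Psh" "tsrc ?t = hp x" "ttgt ?t = hp c" using homsetD[OF t(1)] by simp_all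
  then have Lt: "far L ?t \<in> homset Sh (fob L (hp x)) (fob L (hp c))"
    and sq: "\<eta> (hp c) \<cdot>\<^bsub>Psh\<^esub> ?t = far L ?t \<cdot>\<^bsub>Psh\<^esub> \<eta> (hp x)"
    using functor_far_homset[OF sheafification_functor] unit_natural by fastforce+
  show "far can a \<in> homset Sh (fob can x) (fob can c)" using Lt far by (simp add: fob_can o)
  note \<eta> = unit_hom[OF functor_hp]
  have "app (far L ?t) x (gen x) = app (far L ?t \<cdot>\<^bsub>Psh\<^esub> \<eta> (hp x)) x (\<iota> (ident C x))"
    using app_cmp[OF \<eta> o(2) id_mem_hp[OF o(2)]] by (simp add: gen_def)
  also have "\<dots> = app (\<eta> (hp c)) x (app ?t x (\<iota> (ident C x)))"
    using app_cmp[OF t(1) o(2) id_mem_hp[OF o(2)]] sq by metis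
  also have "\<dots> = app (\<eta> (hp c)) x (act (hp c) a (\<iota> (ident C c)))"
    using t(2) act_hp[OF ident_hom[OF o(1)] a] cmp_ident_right[OF a] by simp
  also have "\<dots> = act (fob L (hp c)) a (gen c)"
    using app_act[OF category_axioms \<eta> a id_mem_hp[OF o(1)]] by (simp add: gen_def)
  finally show "app (far can a) x (gen x) = act (fob can c) a (gen c)" using far by (simp add: fob_can o)
qed

section \<open>Consequences of full faithfulness and atomicity\<close>

lemma cocones: "spans_have_cocones C"
proof (rule ccontr)
  assume "\<not> spans_have_cocones C"
  then obtain f g where fg: "f \<in> arr C" "g \<in> arr C" "src C f = src C g"
    and no: "\<And>h k. h \<in> arr C \<Longrightarrow> k \<in> arr C \<Longrightarrow> src C h = tgt C f \<Longrightarrow> src C k = tgt C g \<Longrightarrow> h \<cdot> f \<noteq> k \<cdot> g"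
    unfolding spans_have_cocones_def by blast
  let ?b = "tgt C g"
  have b: "?b \<in> obj C" using fg tgt_obj by blast
  have empty: "{} \<in> atomic_topology (opcat C) ?b"
    using empty_mem_atomic_topology[OF category_axioms fg no] .
  \<comment> \<open>The empty family has a unique amalgamation, so every sheaf has exactly one
    element at \<open>?b\<close> and, by \<open>can_universal\<close>, receives exactly one map from
    the representable sheaf.\<close>
  have unique: "\<exists>!y. y \<in> fob F ?b" if "sheaf F" for F
    using bspec[OF bspec[OF conjunct2[OF that[unfolded is_sheaf_def]], of ?b] empty] b by simp
  have "\<exists>!t. t \<in> homset Sh (fob can ?b) F" if F: "sheaf F" for F
  proof -
    obtain y where y: "y \<in> fob F ?b" "\<And>y'. y' \<in> fob F ?b \<Longrightarrow> y' = y"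
      using unique[OF F] by blast
    have "app t ?b (gen ?b) = y" if "t \<in> homset Sh (fob can ?b) F" for t
    proof -
      have "t \<in> homset Psh (fob can ?b) F" using that by (simp add: homset_Sh)
      from app_mem[OF this b gen_mem[OF b]] show ?thesis by (rule y(2))
    qed
    then show ?thesis using can_universal[OF b F y(1)] by metis
  qed
  then have "is_initial Sh (fob can ?b)" using sheaf_can[OF b] by (simp add: is_initial_def)
  then show False using atoms b by (simp add: is_atom_def)
qed

lemmas sheaf_iff = is_sheaf_atomic_iff[OF category_axioms cocones]

lemma sheaf_inj:
  assumes "sheaf F" "f \<in> homset C x y" "a \<in> fob F x" "b \<in> fob F x" "act F f a = act F f b"
  shows "a = b"
proof -
  have "inj_on (act F f) (fob F x)" using assms(1) homsetD[OF assms(2)] unfolding sheaf_iff by blast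
  then show ?thesis using assms(3-5) unfolding inj_on_def by blast
qed

text \<open>Full faithfulness identifies arrows \<open>c \<rightarrow> x\<close> with maps between
  representable sheaves, and \<open>can_universal\<close> identifies those with elements. Up to
  isomorphism the hom-functors are thus sheaves.\<close>

lemma can_bij:
  assumes c: "c \<in> obj C" and x: "x \<in> obj C"
  shows "bij_betw (\<lambda>a. act (fob can c) a (gen c)) (homset C c x) (fob (fob can c) x)"
proof -
  have 1: "bij_betw (far can) (homset C c x) (homset Sh (fob can x) (fob can c))"
    using ff c x by (simp add: fully_faithful_def)
  have 2: "bij_betw (\<lambda>t. app t x (gen x)) (homset Sh (fob can x) (fob can c)) (fob (fob can c) x)"
    unfolding bij_betw_def
  proof
    show "inj_on (\<lambda>t. app t x (gen x)) (homset Sh (fob can x) (fob can c))"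
      using can_eqI[OF x] by (intro inj_onI)
    show "(\<lambda>t. app t x (gen x)) ` homset Sh (fob can x) (fob can c) = fob (fob can c) x"
    proof
      show "fob (fob can c) x \<subseteq> (\<lambda>t. app t x (gen x)) ` homset Sh (fob can x) (fob can c)"
        using can_universal[OF x sheaf_can[OF c]] by blast
    qed (use app_mem gen_mem[OF x] x in \<open>fastforce simp: homset_Sh\<close>)
  qed
  show ?thesis
    using bij_betw_trans[OF 1 2] by (rule bij_betw_cong[THEN iffD1, rotated]) (simp add: far_can(2))
qed

lemma can_elementE:
  assumes "c \<in> obj C" "x \<in> obj C" "e \<in> fob (fob can c) x"
  obtains a where "a \<in> homset C c x" "e = act (fob can c) a (gen c)"
  using can_bij[OF assms(1,2)] assms(3) unfolding bij_betw_def by blast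

lemma can_act_eq_iff:
  assumes "a \<in> homset C c x" "b \<in> homset C c x"
  shows "act (fob can c) a (gen c) = act (fob can c) b (gen c) \<longleftrightarrow> a = b"
  using can_bij[OF homset_obj[OF assms(1)]] assms unfolding bij_betw_def inj_on_def by blast

lemma can_act_cmp:
  assumes "a \<in> homset C c x" "f \<in> homset C x y"
  shows "act (fob can c) (f \<cdot> a) (gen c) = act (fob can c) f (act (fob can c) a (gen c))"
  using act_cmp[OF functor_can assms gen_mem] homset_obj[OF assms(1)] by blast

text \<open>Arrows act injectively on any sheaf. On the representable sheaf of \<open>w\<close>,
  whose elements are the arrows out of \<open>w\<close>, the action of \<open>f\<close> is
  postcomposition.\<close>

lemma all_mono: "f \<in> arr C \<Longrightarrow> is_mono C f"
  unfolding is_mono_def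
proof (intro conjI ballI impI)
  fix w g h assume f: "f \<in> arr C" and w: "w \<in> obj C" and g: "g \<in> homset C w (src C f)"
    and h: "h \<in> homset C w (src C f)" and eq: "f \<cdot> g = f \<cdot> h"
  let ?n = "fob can w"
  note mem = act_mem[OF functor_can[OF w] _ gen_mem[OF w]]
  have "act ?n f (act ?n g (gen w)) = act ?n f (act ?n h (gen w))"
    using eq can_act_cmp[OF g arr_homset[OF f]] can_act_cmp[OF h arr_homset[OF f]] by simp
  then have "act ?n g (gen w) = act ?n h (gen w)"
    using sheaf_inj[OF sheaf_can[OF w] arr_homset[OF f] mem[OF g] mem[OF h]] by simp
  then show "g = h" using can_act_eq_iff[OF g h] by simp
qed

lemma mono_cancel:
  assumes "f \<in> homset C x y" "g \<in> homset C w x" "h \<in> homset C w x" "f \<cdot> g = f \<cdot> h"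
  shows "g = h"
  using all_mono[of f] homsetD[OF assms(1)] assms(2-4) homset_obj(1)[OF assms(2)]
  unfolding is_mono_def by blast

text \<open>A pullback in \<open>C\<close> is a pushout in the opposite category, kept by (C2). Maps
  from that pushout of representable sheaves to \<open>F\<close> form a pullback of sets, and
  \<open>can_universal\<close> identifies such maps with elements of \<open>F\<close>.\<close>

lemma sheaf_preserves_pullbacks:
  assumes F: "sheaf F"
  shows "preserves_pullbacks C set_cat F"
proof -
  interpret S: category Sh by (rule category_Sh)
  have "\<exists>!e. e \<in> fob F (src C p) \<and> act F p e = a \<and> act F q e = b"
    if pb: "is_pullback C f g p q" and a: "a \<in> fob F (src C f)" and b: "b \<in> fob F (src C g)"
      and ab: "act F f a = act F g b" for f g p q a b
  proof -
    let ?A = "src C f" and ?B = "src C g" and ?P = "src C p" and ?Z = "tgt C f"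
    have h: "f \<in> homset C ?A ?Z" "g \<in> homset C ?B ?Z" "p \<in> homset C ?P ?A" "q \<in> homset C ?P ?B"
      using pb by (auto simp: is_pullback_def homset_def)
    note o = homset_obj(1)[OF h(1)] homset_obj(1)[OF h(2)] homset_obj(1)[OF h(3)] homset_obj(2)[OF h(1)]
    note far = far_can(1)[OF h(1)] far_can(1)[OF h(2)] far_can(1)[OF h(3)] far_can(1)[OF h(4)]
    have val: "app (t \<cdot>\<^bsub>Sh\<^esub> far can k) y (gen y) = act F k (app t x (gen x))"
      if t: "t \<in> homset Sh (fob can x) F" and k: "k \<in> homset C x y" for t k x y
    proof -
      note xy = homset_obj[OF k]
      have kP: "far can k \<in> homset Psh (fob can y) (fob can x)" and tP: "t \<in> homset Psh (fob can x) F"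
        using far_can(1)[OF k] t by (simp_all add: homset_Sh)
      show ?thesis
        using app_cmp[OF kP xy(2) gen_mem[OF xy(2)], of t] far_can(2)[OF k]
          app_act[OF category_axioms tP k gen_mem[OF xy(1)]] by simp
    qed
    \<comment> \<open>Composition with \<open>far can k\<close> becomes the action of
      \<open>k\<close> on the elements that name the maps, so cocones of sheaves become compatible
      pairs in \<open>F\<close>.\<close>
    have comp: "t \<cdot>\<^bsub>Sh\<^esub> far can k = s \<longleftrightarrow> act F k (app t x (gen x)) = app s y (gen y)"
      if t: "t \<in> homset Sh (fob can x) F" and k: "k \<in> homset C x y" and s: "s \<in> homset Sh (fob can y) F"
      for t k s x y
    proof -
      have tk: "t \<cdot>\<^bsub>Sh\<^esub> far can k \<in> homset Sh (fob can y) F" by (rule S.cmp_hom[OF far_can(1)[OF k] t])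
      show ?thesis using can_eqI[OF homset_obj(2)[OF k] tk s] val[OF t k] by metis
    qed
    have "is_pushout (opcat C) f g p q" using pb by (simp add: is_pushout_def)
    then have "is_pushout Sh (far can f) (far can g) (far can p) (far can q)"
      using pres_pushouts unfolding preserves_pushouts_def by blast
    then have "\<forall>w\<in>obj Sh. \<forall>s\<in>homset Sh (fob can ?A) w. \<forall>t\<in>homset Sh (fob can ?B) w.
        s \<cdot>\<^bsub>Sh\<^esub> far can f = t \<cdot>\<^bsub>Sh\<^esub> far can g \<longrightarrow>
        (\<exists>!k. k \<in> homset Sh (fob can ?P) w \<and> k \<cdot>\<^bsub>Sh\<^esub> far can p = s \<and> k \<cdot>\<^bsub>Sh\<^esub> far can q = t)"
      unfolding is_pushout_def is_pullback_def opcat_sel homset_opcat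
        homsetD(3)[OF far(1)] homsetD(3)[OF far(2)] homsetD(3)[OF far(3)]
      by (elim conjE)
    from bspec[OF this, of F] F have univ: "\<And>s t. s \<in> homset Sh (fob can ?A) F \<Longrightarrow>
        t \<in> homset Sh (fob can ?B) F \<Longrightarrow> s \<cdot>\<^bsub>Sh\<^esub> far can f = t \<cdot>\<^bsub>Sh\<^esub> far can g \<Longrightarrow>
        \<exists>!k. k \<in> homset Sh (fob can ?P) F \<and> k \<cdot>\<^bsub>Sh\<^esub> far can p = s \<and> k \<cdot>\<^bsub>Sh\<^esub> far can q = t"
      unfolding Sh_sel(1) by blast
    obtain s where s: "s \<in> homset Sh (fob can ?A) F" "app s ?A (gen ?A) = a"
      using can_universal[OF o(1) F a] by blast
    obtain t where t: "t \<in> homset Sh (fob can ?B) F" "app t ?B (gen ?B) = b"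
      using can_universal[OF o(2) F b] by blast
    have tg: "t \<cdot>\<^bsub>Sh\<^esub> far can g \<in> homset Sh (fob can ?Z) F" by (rule S.cmp_hom[OF far(2) t(1)])
    have "s \<cdot>\<^bsub>Sh\<^esub> far can f = t \<cdot>\<^bsub>Sh\<^esub> far can g"
      unfolding comp[OF s(1) h(1) tg] using val[OF t(1) h(2)] s(2) t(2) ab by simp
    from univ[OF s(1) t(1) this]
    obtain k where k: "k \<in> homset Sh (fob can ?P) F" "k \<cdot>\<^bsub>Sh\<^esub> far can p = s" "k \<cdot>\<^bsub>Sh\<^esub> far can q = t"
      and unique: "\<And>k'. k' \<in> homset Sh (fob can ?P) F \<Longrightarrow> k' \<cdot>\<^bsub>Sh\<^esub> far can p = s \<Longrightarrow>
        k' \<cdot>\<^bsub>Sh\<^esub> far can q = t \<Longrightarrow> k' = k"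
      by blast
    show ?thesis
    proof (rule ex1I[of _ "app k ?P (gen ?P)"])
      have "k \<in> homset Psh (fob can ?P) F" using k(1) by (simp add: homset_Sh)
      then have "app k ?P (gen ?P) \<in> fob F ?P" by (rule app_mem[OF _ o(3) gen_mem[OF o(3)]])
      then show "app k ?P (gen ?P) \<in> fob F ?P \<and> act F p (app k ?P (gen ?P)) = a \<and>
          act F q (app k ?P (gen ?P)) = b"
        using k(2,3) comp[OF k(1) h(3) s(1)] comp[OF k(1) h(4) t(1)] s(2) t(2) by simp
      fix e assume e: "e \<in> fob F ?P \<and> act F p e = a \<and> act F q e = b"
      then obtain k' where k': "k' \<in> homset Sh (fob can ?P) F" "app k' ?P (gen ?P) = e"
        using can_universal[OF o(3) F] by blast
      have "k' = k"
        using unique[OF k'(1)] comp[OF k'(1) h(3) s(1)] comp[OF k'(1) h(4) t(1)] s(2) t(2) e k'(2) by simp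
      then show "e = app k ?P (gen ?P)" using k'(2) by simp
    qed
  qed
  then show ?thesis
    unfolding preserves_pullbacks_set_iff[OF category_axioms sheaf_functor[OF F]] by blast
qed

end

context atomic_setting
begin

section \<open>Pullback-preserving functors are sheaves\<close>

lemma pullback_exists:
  assumes "f \<in> homset C x z" "g \<in> homset C y z"
  obtains w p q where "is_pullback C f g p q" "p \<in> homset C w x" "q \<in> homset C w y" "f \<cdot> p = g \<cdot> q"
    "w \<in> obj C"
proof -
  have "\<exists>p q. is_pullback C f g p q"
    using pushouts homsetD[OF assms(1)] homsetD[OF assms(2)]
    unfolding has_pushouts_def is_pushout_def opcat_opcat opcat_sel by simp
  then obtain p q where pb: "is_pullback C f g p q" by blast
  have "p \<in> homset C (src C p) x" "q \<in> homset C (src C p) y" "f \<cdot> p = g \<cdot> q"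
    using pb homsetD[OF assms(1)] homsetD[OF assms(2)] by (simp_all add: is_pullback_def homset_def)
  then show thesis using that pb homset_obj(1) by blast
qed

lemma pullback_lift:
  assumes "is_pullback C f g p q" "p \<in> homset C w x" "q \<in> homset C w y"
    and "a \<in> homset C v x" "b \<in> homset C v y" "f \<cdot> a = g \<cdot> b"
  obtains k where "k \<in> homset C v w" "p \<cdot> k = a" "q \<cdot> k = b"
proof -
  have "\<forall>w\<in>obj C. \<forall>a\<in>homset C w (src C f). \<forall>b\<in>homset C w (src C g). f \<cdot> a = g \<cdot> b \<longrightarrow>
      (\<exists>!k. k \<in> homset C w (src C p) \<and> p \<cdot> k = a \<and> q \<cdot> k = b)"
    and "src C f = x" "src C g = y" "src C p = w"
    using assms(1) homsetD[OF assms(2)] homsetD[OF assms(3)] unfolding is_pullback_def by auto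
  then show thesis using that assms(4-6) homset_obj(1)[OF assms(4)] by blast
qed

text \<open>Pull \<open>h\<close> back along \<open>g\<close>. Since \<open>F\<close> preserves this
  pullback, \<open>e\<close> is hit by the action of the projection \<open>p\<close> to
  \<open>I\<close>; minimality makes \<open>p\<close> invertible, and then \<open>h\<close> factors
  through \<open>g\<close>.\<close>

lemma minimal_support_factors:
  assumes F: "is_functor C set_cat F" and pp: "preserves_pullbacks C set_cat F"
    and e: "e \<in> fob F I"
    and minimal: "\<And>k d. k \<in> arr C \<Longrightarrow> tgt C k = I \<Longrightarrow> d \<in> fob F (src C k) \<Longrightarrow> act F k d = e \<Longrightarrow> is_iso C k"
    and h: "h \<in> homset C I X" and g: "g \<in> homset C Z X" and z: "z \<in> fob F Z"
    and eq: "act F h e = act F g z"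
  obtains v where "v \<in> homset C I Z" "h = g \<cdot> v"
proof -
  obtain w p q where pb: "is_pullback C h g p q" and p: "p \<in> homset C w I" and q: "q \<in> homset C w Z"
    and comm: "h \<cdot> p = g \<cdot> q"
    using pullback_exists[OF h g] by metis
  obtain d where d: "d \<in> fob F w" "act F p d = e"
    using preserves_pullbacksD[OF category_axioms F pp pb, of e z] e z eq
      homsetD[OF h] homsetD[OF g] homsetD[OF p] by metis
  then have "is_iso C p" using minimal[of p d] homsetD[OF p] by simp
  then obtain p' where p': "p' \<in> homset C I w" "p \<cdot> p' = ident C I" using is_isoE[OF _ p] by metis
  have "h = h \<cdot> (p \<cdot> p')" using p'(2) cmp_ident_right[OF h] by simp
  also have "\<dots> = (g \<cdot> q) \<cdot> p'" using cmp_assoc[OF p'(1) p h] comm by simp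
  also have "\<dots> = g \<cdot> (q \<cdot> p')" using cmp_assoc[OF p'(1) q g] .
  finally show thesis using that cmp_hom[OF p'(1) q] by blast
qed

lemma sheaf_if_preserves_pullbacks:
  assumes def: "\<forall>f\<in>arr C. definable_by_self_intersections C f"
    and F: "is_functor C set_cat F" and pp: "preserves_pullbacks C set_cat F"
  shows "sheaf F"
proof -
  have "e \<in> act F f ` fob F (src C f)" if f: "f \<in> arr C" and e: "self_matching C F f e" for f e
  proof -
    let ?A = "src C f" and ?B = "tgt C f"
    have eB: "e \<in> fob F ?B"
      and match: "\<And>X \<alpha> \<beta>. \<alpha> \<in> homset C ?B X \<Longrightarrow> \<beta> \<in> homset C ?B X \<Longrightarrow> \<alpha> \<cdot> f = \<beta> \<cdot> f \<Longrightarrow>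
        act F \<alpha> e = act F \<beta> e"
      using e unfolding self_matching_def by blast+
    have B: "?B \<in> obj C" using f tgt_obj by blast
    \<comment> \<open>\<open>\<Phi> m\<close> says that \<open>m\<close> supports \<open>e\<close>;
      the identity does, so well-foundedness provides a minimal support.\<close>
    define \<Phi> where "\<Phi> m \<longleftrightarrow> (\<exists>d\<in>fob F (src C m). act F m d = e)" for m
    have "ident C ?B \<in> arr C" "\<Phi> (ident C ?B)"
      using ident_arr[OF B] act_ident[OF F B eB] eB by (auto simp: \<Phi>_def)
    from exists_minimal_arrow[where \<Phi> = \<Phi>, OF category_axioms wf this]
    obtain m where m: "m \<in> arr C" "tgt C m = ?B" "\<Phi> m"
      and minimal: "\<And>k. k \<in> arr C \<Longrightarrow> tgt C k = src C m \<Longrightarrow> \<Phi> (m \<cdot> k) \<Longrightarrow> is_iso C k"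
      using ident_arr[OF B] by metis
    let ?I = "src C m"
    have mh: "m \<in> homset C ?I ?B" using m by (simp add: homset_def)
    obtain d where d: "d \<in> fob F ?I" "act F m d = e" using m(3) by (auto simp: \<Phi>_def)
    have min: "is_iso C k" if k: "k \<in> arr C" "tgt C k = ?I" and c: "c \<in> fob F (src C k)" "act F k c = d" for k c
    proof -
      have kh: "k \<in> homset C (src C k) ?I" using k by (simp add: homset_def)
      have "\<Phi> (m \<cdot> k)"
        using c d(2) act_cmp[OF F kh mh c(1)] homsetD(2)[OF cmp_hom[OF kh mh]] by (auto simp: \<Phi>_def)
      then show ?thesis using minimal k by blast
    qed
    have "\<exists>v\<in>homset C ?I ?B. \<beta> \<cdot> m = \<alpha> \<cdot> v"
      if \<alpha>: "\<alpha> \<in> homset C ?B X" and \<beta>: "\<beta> \<in> homset C ?B X" and eq: "\<alpha> \<cdot> f = \<beta> \<cdot> f" for X \<alpha> \<beta>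
    proof -
      \<comment> \<open>Matching lets \<open>\<alpha>\<close> replace \<open>\<beta>\<close> on
        \<open>e\<close>, so \<open>minimal_support_factors\<close> applies to
        \<open>\<beta> \<cdot> m\<close> at \<open>d\<close> and \<open>\<alpha>\<close> at
        \<open>e\<close>.\<close>
      have "act F (\<beta> \<cdot> m) d = act F \<alpha> e"
        using act_cmp[OF F mh \<beta> d(1)] d(2) match[OF \<alpha> \<beta> eq] by simp
      then obtain v where "v \<in> homset C ?I ?B" "\<beta> \<cdot> m = \<alpha> \<cdot> v"
        by (rule minimal_support_factors[OF F pp d(1) _ cmp_hom[OF mh \<beta>] \<alpha> eB, rotated])
          (blast, rule min)
      then show ?thesis by blast
    qed
    \<comment> \<open>The support satisfies the condition in the definition of definability, so it
      factors through \<open>f\<close>; acting with the factor \<open>w\<close> on \<open>d\<close>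
      gives the descended element.\<close>
    then obtain w where w: "w \<in> homset C ?I ?A" "m = f \<cdot> w"
      using def f m(1,2) unfolding definable_by_self_intersections_def by blast
    have "e = act F f (act F w d)" using act_cmp[OF F w(1) arr_homset[OF f] d(1)] w(2) d(2) by simp
    then show ?thesis using act_mem[OF F w(1) d(1)] by blast
  qed
  then show ?thesis
    unfolding sheaf_iff using F act_inj_of_mono[OF category_axioms F pp all_mono] by blast
qed


section \<open>Quotients of representable sheaves\<close>

text \<open>Every element is the action of some arrow on \<open>gen c\<close>. Naturality and
  injectivity of that action carry the agreement at \<open>e\<close> back to \<open>gen c\<close>,
  whose image determines an endomorphism.\<close>

lemma can_endo_free:
  assumes c: "c \<in> obj C" and \<sigma>: "\<sigma> \<in> homset Sh (fob can c) (fob can c)"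
    and \<tau>: "\<tau> \<in> homset Sh (fob can c) (fob can c)"
    and x: "x \<in> obj C" and e: "e \<in> fob (fob can c) x" and eq: "app \<sigma> x e = app \<tau> x e"
  shows "\<sigma> = \<tau>"
proof -
  let ?n = "fob can c"
  obtain a where a: "a \<in> homset C c x" "e = act ?n a (gen c)" using can_elementE[OF c x e] .
  have P: "\<sigma> \<in> homset Psh ?n ?n" "\<tau> \<in> homset Psh ?n ?n" using \<sigma> \<tau> by (simp_all add: homset_Sh)
  have "act ?n a (app \<sigma> c (gen c)) = act ?n a (app \<tau> c (gen c))"
    using app_act[OF category_axioms P(1) a(1) gen_mem[OF c]]
      app_act[OF category_axioms P(2) a(1) gen_mem[OF c]] eq a(2) by simp
  then have "app \<sigma> c (gen c) = app \<tau> c (gen c)"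
    using sheaf_inj[OF sheaf_can[OF c] a(1)] app_mem[OF P(1) c gen_mem[OF c]]
      app_mem[OF P(2) c gen_mem[OF c]] by blast
  then show ?thesis using can_eqI[OF c \<sigma> \<tau>] by blast
qed

lemma subgroup_nat_action:
  assumes c: "c \<in> obj C" and G: "subgroup G (aut_group Sh (fob can c))"
  shows "nat_action C (fob can c) G"
proof -
  let ?n = "fob can c"
  have "?n \<in> obj Sh" using sheaf_can[OF c] by simp
  then interpret A: group "aut_group Sh ?n" by (rule category.group_aut_group[OF category_Sh])
  have G_hom: "\<sigma> \<in> homset Psh ?n ?n" if "\<sigma> \<in> G" for \<sigma>
  proof -
    have "\<sigma> \<in> carrier (aut_group Sh ?n)" using subgroup.mem_carrier[OF G that] .
    then show ?thesis by (simp add: aut_group_def homset_Sh)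
  qed
  show ?thesis
  proof (unfold_locales)
    show "is_functor C set_cat ?n" using functor_can[OF c] .
    show "ident Psh ?n \<in> G" using subgroup.one_closed[OF G] by (simp add: aut_group_def)
    fix \<sigma> assume \<sigma>: "\<sigma> \<in> G"
    show "\<sigma> \<in> homset Psh ?n ?n" using G_hom[OF \<sigma>] .
    show "\<sigma> \<cdot>\<^bsub>Psh\<^esub> \<tau> \<in> G" if "\<tau> \<in> G" for \<tau>
      using subgroup.m_closed[OF G \<sigma> that] by (simp add: aut_group_def)
    show "\<exists>\<tau>\<in>G. \<tau> \<cdot>\<^bsub>Psh\<^esub> \<sigma> = ident Psh ?n"
      using subgroup.m_inv_closed[OF G \<sigma>] A.l_inv[OF subgroup.mem_carrier[OF G \<sigma>]]
      by (intro bexI[of _ "inv\<^bsub>aut_group Sh ?n\<^esub> \<sigma>"]) (simp_all add: aut_group_def)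
  qed
qed

lemma quotient_preserves_pullbacks:
  assumes c: "c \<in> obj C" and G: "subgroup G (aut_group Sh (fob can c))"
    and Q: "is_common_coequalizer Psh (fob can c) G Q q"
  shows "is_functor C set_cat Q" "preserves_pullbacks C set_cat Q"
proof -
  interpret A: nat_action C "fob can c" G by (rule subgroup_nat_action[OF c G])
  have "\<sigma> \<in> homset Sh (fob can c) (fob can c)" if "\<sigma> \<in> G" for \<sigma>
    using A.endo[OF that] sheaf_can[OF c] by (simp add: homset_Sh)
  then show "is_functor C set_cat Q" "preserves_pullbacks C set_cat Q"
    using A.coequalizer_preserves_pullbacks[OF Q sheaf_preserves_pullbacks[OF sheaf_can[OF c]]]
      can_endo_free[OF c] by blast+
qed


section \<open>Definability from quotients\<close>

text \<open>The hypothesis on \<open>u\<close> in \<open>definable_by_self_intersections\<close>.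
  The quantifier over \<open>X\<close> runs over the whole type, since an arrow into
  \<open>X\<close> makes it an object.\<close>

definition self_intersecting :: "'a \<Rightarrow> 'a \<Rightarrow> bool" where
  "self_intersecting f u \<longleftrightarrow> (\<forall>X. \<forall>\<alpha>\<in>homset C (tgt C f) X. \<forall>\<beta>\<in>homset C (tgt C f) X.
     \<alpha> \<cdot> f = \<beta> \<cdot> f \<longrightarrow> (\<exists>v\<in>homset C (src C u) (tgt C f). \<beta> \<cdot> u = \<alpha> \<cdot> v))"

lemma self_intersectingD:
  assumes "self_intersecting f u" and u: "u \<in> homset C Y B" and f: "f \<in> homset C A B"
    and "\<alpha> \<in> homset C B X" "\<beta> \<in> homset C B X" "\<alpha> \<cdot> f = \<beta> \<cdot> f"
  shows "\<exists>v\<in>homset C Y B. \<beta> \<cdot> u = \<alpha> \<cdot> v"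
  using assms(1,4-6) unfolding self_intersecting_def homsetD(2)[OF u] homsetD(3)[OF f] by blast

lemma self_intersectingI:
  assumes "u \<in> homset C Y B" "f \<in> homset C A B"
    and "\<And>X \<alpha> \<beta>. \<alpha> \<in> homset C B X \<Longrightarrow> \<beta> \<in> homset C B X \<Longrightarrow> \<alpha> \<cdot> f = \<beta> \<cdot> f \<Longrightarrow>
      \<exists>v\<in>homset C Y B. \<beta> \<cdot> u = \<alpha> \<cdot> v"
  shows "self_intersecting f u"
  unfolding self_intersecting_def homsetD(2)[OF assms(1)] homsetD(3)[OF assms(2)]
  using assms(3) by blast

lemma definable_iff:
  assumes "f \<in> arr C"
  shows "definable_by_self_intersections C f \<longleftrightarrow>
    (\<forall>u\<in>arr C. tgt C u = tgt C f \<longrightarrow> self_intersecting f u \<longrightarrow>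
      (\<exists>w\<in>homset C (src C u) (src C f). u = f \<cdot> w))"
proof -
  have "self_intersecting f u \<longleftrightarrow> (\<forall>X\<in>obj C. \<forall>\<alpha>\<in>homset C (tgt C f) X. \<forall>\<beta>\<in>homset C (tgt C f) X.
     \<alpha> \<cdot> f = \<beta> \<cdot> f \<longrightarrow> (\<exists>v\<in>homset C (src C u) (tgt C f). \<beta> \<cdot> u = \<alpha> \<cdot> v))" for u
    unfolding self_intersecting_def using homset_obj(2) by blast
  then show ?thesis unfolding definable_by_self_intersections_def by simp
qed

text \<open>This is the intersection of all self-intersections of \<open>f\<close>; well-foundedness reduces it to a
  finite one.\<close>

lemma largest_self_intersecting:
  assumes f: "f \<in> homset C A B"
  obtains I i where "i \<in> homset C I B" "self_intersecting f i"
    "\<And>Y u. u \<in> homset C Y B \<Longrightarrow> self_intersecting f u \<Longrightarrow> \<exists>w\<in>homset C Y I. u = i \<cdot> w"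
proof -
  have B: "B \<in> obj C" using homset_obj(2)[OF f] .
  \<comment> \<open>\<open>\<Phi> m\<close> says that \<open>m\<close> is an upper bound: all
    self-intersecting arrows factor through it. A minimal upper bound turns out to be
    self-intersecting itself, hence largest.\<close>
  define \<Phi> where "\<Phi> m \<longleftrightarrow> (\<forall>Y. \<forall>u\<in>homset C Y B. self_intersecting f u \<longrightarrow>
    (\<exists>w\<in>homset C Y (src C m). u = m \<cdot> w))" for m
  have "ident C B \<in> arr C" "\<Phi> (ident C B)"
    using ident_arr[OF B] cmp_ident_left by (auto simp: \<Phi>_def)
  from exists_minimal_arrow[where \<Phi> = \<Phi>, OF category_axioms wf this]
  obtain i where i: "i \<in> arr C" "tgt C i = B" "\<Phi> i"
    and minimal: "\<And>k. k \<in> arr C \<Longrightarrow> tgt C k = src C i \<Longrightarrow> \<Phi> (i \<cdot> k) \<Longrightarrow> is_iso C k"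
    using ident_arr[OF B] by metis
  define I where "I = src C i"
  have ih: "i \<in> homset C I B" using i by (simp add: homset_def I_def)
  have largest: "\<exists>w\<in>homset C Y I. u = i \<cdot> w" if "u \<in> homset C Y B" "self_intersecting f u" for u Y
    using i(3) that unfolding \<Phi>_def I_def by blast
  have "self_intersecting f i"
  proof (rule self_intersectingI[OF ih f])
    fix X \<alpha> \<beta> assume \<alpha>: "\<alpha> \<in> homset C B X" and \<beta>: "\<beta> \<in> homset C B X" and eq: "\<alpha> \<cdot> f = \<beta> \<cdot> f"
    \<comment> \<open>\<open>q\<close> is the part of \<open>B\<close> that \<open>\<beta>\<close>
      sends into \<open>\<alpha>\<close>: an arrow \<open>u\<close> factors through \<open>q\<close>
      exactly when \<open>\<beta> \<cdot> u\<close> factors through \<open>\<alpha>\<close>.\<close>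
    obtain P p q where pb: "is_pullback C \<alpha> \<beta> p q" and p: "p \<in> homset C P B" and q: "q \<in> homset C P B"
      and pq: "\<alpha> \<cdot> p = \<beta> \<cdot> q"
      using pullback_exists[OF \<alpha> \<beta>] by metis
    \<comment> \<open>Intersecting \<open>i\<close> with \<open>q\<close> keeps it an upper bound,
      so minimality makes \<open>r\<close> invertible and \<open>i\<close> itself factors through
      \<open>q\<close>.\<close>
    obtain R r s where pb': "is_pullback C i q r s" and r: "r \<in> homset C R I" and s: "s \<in> homset C R P"
      and rs: "i \<cdot> r = q \<cdot> s"
      using pullback_exists[OF ih q] by metis
    have "\<exists>w\<in>homset C Y (src C (i \<cdot> r)). u = (i \<cdot> r) \<cdot> w"
      if u: "u \<in> homset C Y B" and su: "self_intersecting f u" for Y u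
    proof -
      obtain v where v: "v \<in> homset C Y B" "\<beta> \<cdot> u = \<alpha> \<cdot> v"
        using self_intersectingD[OF su u f \<alpha> \<beta> eq] by blast
      obtain k where k: "k \<in> homset C Y P" "q \<cdot> k = u"
        using pullback_lift[OF pb p q v(1) u] v(2) by metis
      obtain w where w: "w \<in> homset C Y I" "u = i \<cdot> w" using largest[OF u su] by blast
      obtain l where l: "l \<in> homset C Y R" "r \<cdot> l = w"
        using pullback_lift[OF pb' r s w(1) k(1)] w(2) k(2) by metis
      have "u = (i \<cdot> r) \<cdot> l" using cmp_assoc[OF l(1) r ih] l(2) w(2) by simp
      then show ?thesis using l(1) homsetD(2)[OF cmp_hom[OF r ih]] by blast
    qed
    then have "\<Phi> (i \<cdot> r)" unfolding \<Phi>_def by blast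
    then have "is_iso C r" using minimal homsetD[OF r] by (simp add: I_def)
    then obtain r' where r': "r' \<in> homset C I R" "r \<cdot> r' = ident C I" using is_isoE[OF _ r] by metis
    have sr: "s \<cdot> r' \<in> homset C I P" using cmp_hom[OF r'(1) s] .
    have "i = i \<cdot> (r \<cdot> r')" using r'(2) cmp_ident_right[OF ih] by simp
    also have "\<dots> = q \<cdot> (s \<cdot> r')" using cmp_assoc[OF r'(1) r ih] cmp_assoc[OF r'(1) s q] rs by simp
    finally have "\<beta> \<cdot> i = \<beta> \<cdot> (q \<cdot> (s \<cdot> r'))" by simp
    also have "\<dots> = \<alpha> \<cdot> (p \<cdot> (s \<cdot> r'))"
      using cmp_assoc[OF sr q \<beta>] cmp_assoc[OF sr p \<alpha>] pq by simp
    finally show "\<exists>v\<in>homset C I B. \<beta> \<cdot> i = \<alpha> \<cdot> v" using cmp_hom[OF sr p] by blast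
  qed
  then show thesis using that ih largest by blast
qed

text \<open>Repeating \<open>s\<close> forever is a descending chain, in which some arrow,
  necessarily \<open>s\<close>, is invertible.\<close>

lemma endo_iso:
  assumes "s \<in> homset C x x"
  shows "is_iso C s"
  using chain_has_iso[OF category_axioms wf, of "\<lambda>_. s" "\<lambda>_. x"] assms by simp

text \<open>The factor \<open>v\<close> of \<open>\<beta> i\<close> through \<open>\<alpha>\<close> again satisfies the self-intersection condition, because
  \<open>(\<alpha>, \<beta>)\<close> can be amalgamated with any other pair of arrows that agree on \<open>f\<close>.\<close>

lemma self_intersection_automorphism:
  assumes f: "f \<in> homset C A B" and i: "i \<in> homset C I B" and si: "self_intersecting f i"
    and largest: "\<And>Y u. u \<in> homset C Y B \<Longrightarrow> self_intersecting f u \<Longrightarrow> \<exists>w\<in>homset C Y I. u = i \<cdot> w"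
    and \<alpha>: "\<alpha> \<in> homset C B X" and \<beta>: "\<beta> \<in> homset C B X" and eq: "\<alpha> \<cdot> f = \<beta> \<cdot> f"
  obtains s where "s \<in> homset C I I" "is_iso C s" "\<beta> \<cdot> i = (\<alpha> \<cdot> i) \<cdot> s"
proof -
  obtain v where v: "v \<in> homset C I B" "\<beta> \<cdot> i = \<alpha> \<cdot> v" using self_intersectingD[OF si i f \<alpha> \<beta> eq] by blast
  have "self_intersecting f v"
  proof (rule self_intersectingI[OF v(1) f])
    fix X' \<alpha>' \<beta>' assume \<alpha>': "\<alpha>' \<in> homset C B X'" and \<beta>': "\<beta>' \<in> homset C B X'" and eq': "\<alpha>' \<cdot> f = \<beta>' \<cdot> f"
    \<comment> \<open>A cocone over \<open>\<alpha>\<close> and \<open>\<beta>'\<close> makes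
      \<open>\<delta>' \<cdot> \<alpha>'\<close> and \<open>\<delta> \<cdot> \<beta>\<close> agree
      on \<open>f\<close>, so the condition on \<open>i\<close> can be used for this pair.\<close>
    obtain \<delta> \<delta>' where "\<delta> \<in> arr C" "\<delta>' \<in> arr C" "src C \<delta> = X" "src C \<delta>' = X'" and am: "\<delta> \<cdot> \<alpha> = \<delta>' \<cdot> \<beta>'"
      using cocones homsetD[OF \<alpha>] homsetD[OF \<beta>'] unfolding spans_have_cocones_def by metis
    then obtain W where \<delta>: "\<delta> \<in> homset C X W" and \<delta>': "\<delta>' \<in> homset C X' W"
      using cmp_arr(3)[of \<alpha> \<delta>] cmp_arr(3)[of \<beta>' \<delta>'] homsetD[OF \<alpha>] homsetD[OF \<beta>']
      by (auto simp: homset_def)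
    have "(\<delta>' \<cdot> \<alpha>') \<cdot> f = (\<delta>' \<cdot> \<beta>') \<cdot> f"
      using cmp_assoc[OF f \<alpha>' \<delta>'] cmp_assoc[OF f \<beta>' \<delta>'] eq' by simp
    also have "\<dots> = (\<delta> \<cdot> \<beta>) \<cdot> f"
      using cmp_assoc[OF f \<alpha> \<delta>] cmp_assoc[OF f \<beta> \<delta>] eq am by simp
    finally obtain v' where v': "v' \<in> homset C I B" "(\<delta> \<cdot> \<beta>) \<cdot> i = (\<delta>' \<cdot> \<alpha>') \<cdot> v'"
      using self_intersectingD[OF si i f cmp_hom[OF \<alpha>' \<delta>'] cmp_hom[OF \<beta> \<delta>]] by blast
    have "\<delta>' \<cdot> (\<beta>' \<cdot> v) = (\<delta> \<cdot> \<alpha>) \<cdot> v" using cmp_assoc[OF v(1) \<beta>' \<delta>'] am by simp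
    also have "\<dots> = (\<delta> \<cdot> \<beta>) \<cdot> i" using cmp_assoc[OF v(1) \<alpha> \<delta>] cmp_assoc[OF i \<beta> \<delta>] v(2) by simp
    also have "\<dots> = \<delta>' \<cdot> (\<alpha>' \<cdot> v')" using v'(2) cmp_assoc[OF v'(1) \<alpha>' \<delta>'] by simp
    \<comment> \<open>All arrows are mono, so the amalgamating \<open>\<delta>'\<close> cancels on
      the left.\<close>
    finally have "\<beta>' \<cdot> v = \<alpha>' \<cdot> v'"
      using mono_cancel[OF \<delta>' cmp_hom[OF v(1) \<beta>'] cmp_hom[OF v'(1) \<alpha>']] by blast
    then show "\<exists>v'\<in>homset C I B. \<beta>' \<cdot> v = \<alpha>' \<cdot> v'" using v'(1) by blast
  qed
  \<comment> \<open>As \<open>i\<close> is largest, \<open>v\<close> factors through it; the factor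
    is an endomorphism, hence invertible by \<open>endo_iso\<close>.\<close>
  then obtain s where s: "s \<in> homset C I I" "v = i \<cdot> s" using largest[OF v(1)] by blast
  have "\<beta> \<cdot> i = (\<alpha> \<cdot> i) \<cdot> s" using v(2) s(2) cmp_assoc[OF s(1) i \<alpha>] by simp
  then show thesis using that s(1) endo_iso[OF s(1)] by blast
qed

text \<open>\<open>can_universal\<close> yields endomorphisms \<open>\<sigma>\<close> and
  \<open>\<rho>\<close> that send the generator to the actions of \<open>s\<close> and of its
  inverse on it; that they are mutually inverse is tested on the generator.\<close>

lemma automorphism_of_iso:
  assumes s: "s \<in> homset C c c" "is_iso C s"
  obtains \<sigma> where "\<sigma> \<in> carrier (aut_group Sh (fob can c))"
    "app \<sigma> c (gen c) = act (fob can c) s (gen c)"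
proof -
  interpret S: category Sh by (rule category_Sh)
  let ?n = "fob can c"
  have c: "c \<in> obj C" using homset_obj(1)[OF s(1)] .
  note mem = act_mem[OF functor_can[OF c] _ gen_mem[OF c]]
  obtain r where r: "r \<in> homset C c c" "r \<cdot> s = ident C c" "s \<cdot> r = ident C c"
    using is_isoE[OF s(2,1)] .
  obtain \<sigma> where \<sigma>: "\<sigma> \<in> homset Sh ?n ?n" "app \<sigma> c (gen c) = act ?n s (gen c)"
    using can_universal[OF c sheaf_can[OF c] mem[OF s(1)]] by blast
  obtain \<rho> where \<rho>: "\<rho> \<in> homset Sh ?n ?n" "app \<rho> c (gen c) = act ?n r (gen c)"
    using can_universal[OF c sheaf_can[OF c] mem[OF r(1)]] by blast
  have id: "ident Sh ?n \<in> homset Sh ?n ?n" using S.ident_hom sheaf_can[OF c] by simp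
  \<comment> \<open>On the generator, \<open>\<tau>\<close> after \<open>\<tau>'\<close> is the
    action of \<open>t' \<cdot> t\<close>: passing to representable sheaves reverses the
    order.\<close>
  have inverse: "\<tau> \<cdot>\<^bsub>Sh\<^esub> \<tau>' = ident Sh ?n"
    if \<tau>: "\<tau> \<in> homset Sh ?n ?n" "app \<tau> c (gen c) = act ?n t (gen c)"
      and \<tau>': "\<tau>' \<in> homset Sh ?n ?n" "app \<tau>' c (gen c) = act ?n t' (gen c)"
      and t: "t \<in> homset C c c" "t' \<in> homset C c c" "t' \<cdot> t = ident C c" for \<tau> \<tau>' t t'
  proof (rule can_eqI[OF c S.cmp_hom[OF \<tau>'(1) \<tau>(1)] id])
    have P: "\<tau> \<in> homset Psh ?n ?n" "\<tau>' \<in> homset Psh ?n ?n" using \<tau>(1) \<tau>'(1) by (simp_all add: homset_Sh)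
    have "app (\<tau> \<cdot>\<^bsub>Psh\<^esub> \<tau>') c (gen c) = app \<tau> c (act ?n t' (gen c))"
      using app_cmp[OF P(2) c gen_mem[OF c]] \<tau>'(2) by simp
    also have "\<dots> = act ?n t' (act ?n t (gen c))"
      using app_act[OF category_axioms P(1) t(2) gen_mem[OF c]] \<tau>(2) by simp
    also have "\<dots> = gen c"
      using can_act_cmp[OF t(1,2)] t(3) act_ident[OF functor_can[OF c] c gen_mem[OF c]] by simp
    finally show "app (\<tau> \<cdot>\<^bsub>Sh\<^esub> \<tau>') c (gen c) = app (ident Sh ?n) c (gen c)"
      using app_ident[OF c gen_mem[OF c]] by simp
  qed
  have "is_iso Sh \<sigma>"
    by (rule S.is_isoI[OF \<sigma>(1) \<rho>(1) inverse[OF \<rho> \<sigma> r(1) s(1) r(3)] inverse[OF \<sigma> \<rho> s(1) r(1) r(2)]])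
  then show thesis using that[of \<sigma>] \<sigma> by (simp add: aut_group_def)
qed

lemma definable_if_quotients_sheaves:
  assumes quot: "\<And>n G Q q. is_representable_atom (opcat C) \<iota> L n \<Longrightarrow> subgroup G (aut_group Sh n) \<Longrightarrow>
      is_common_coequalizer Psh n G Q q \<Longrightarrow> sheaf Q"
    and "f \<in> arr C"
  shows "definable_by_self_intersections C f"
proof -
  define A B where "A = src C f" and "B = tgt C f"
  have f: "f \<in> homset C A B" using assms(2) by (simp add: A_def B_def homset_def)
  obtain I i where i: "i \<in> homset C I B" and si: "self_intersecting f i"
    and largest: "\<And>Y u. u \<in> homset C Y B \<Longrightarrow> self_intersecting f u \<Longrightarrow> \<exists>w\<in>homset C Y I. u = i \<cdot> w"
    using largest_self_intersecting[OF f] by metis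
  note I = homset_obj(1)[OF i]
  let ?n = "fob can I"
  \<comment> \<open>The full automorphism group is taken so that all automorphisms \<open>s\<close>
    of \<open>I\<close> arising from self-intersections become trivial in the quotient.\<close>
  let ?G = "carrier (aut_group Sh ?n)"
  have "?n \<in> obj Sh" using sheaf_can[OF I] by simp
  then have G: "subgroup ?G (aut_group Sh ?n)"
    using category.group_aut_group[OF category_Sh] group.subgroup_self by blast
  interpret N: nat_action C ?n ?G by (rule subgroup_nat_action[OF I G])
  note Q = N.quot_coequalizer
  have "is_representable_atom (opcat C) \<iota> L ?n"
    using atoms I by (auto simp: is_representable_atom_def)
  then have sheafQ: "sheaf N.quot" using quot G Q by blast
  note FQ = sheaf_functor[OF sheafQ]
  note mem = act_mem[OF functor_can[OF I] _ gen_mem[OF I]]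
  \<comment> \<open>The class of an arrow \<open>a\<close> out of \<open>I\<close>, regarded as an
    element of the representable sheaf.\<close>
  define cls where "cls x a = app N.quot_map x (act ?n a (gen I))" for x a
  have cls_mem: "cls x a \<in> fob N.quot x" if "a \<in> homset C I x" for x a
    unfolding cls_def using app_mem[OF N.quot_map_hom homset_obj(2)[OF that] mem[OF that]] .
  have cls_act: "act N.quot g (cls x a) = cls y (g \<cdot> a)" if "a \<in> homset C I x" "g \<in> homset C x y" for a g x y
    using app_act[OF category_axioms N.quot_map_hom that(2) mem[OF that(1)]] can_act_cmp[OF that]
    by (simp add: cls_def)
  have orbit_cls: "cls x a = cls x b \<longleftrightarrow> N.orbit x (act ?n a (gen I)) (act ?n b (gen I))"
    if "a \<in> homset C I x" "b \<in> homset C I x" for a b x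
    unfolding cls_def
    using N.coequalizer_elementwise(1)[OF Q homset_obj(2)[OF that(1)] mem[OF that(1)] mem[OF that(2)]] .
  \<comment> \<open>Precomposition with an automorphism of \<open>I\<close> is the effect of a
    member of \<open>?G\<close>, so it does not change the class.\<close>
  have cls_iso: "cls x (a \<cdot> s) = cls x a" if a: "a \<in> homset C I x" and s: "s \<in> homset C I I" "is_iso C s" for x a s
  proof -
    obtain \<sigma> where \<sigma>: "\<sigma> \<in> ?G" "app \<sigma> I (gen I) = act ?n s (gen I)"
      using automorphism_of_iso[OF s] .
    have "act ?n (a \<cdot> s) (gen I) = app \<sigma> x (act ?n a (gen I))"
      using can_act_cmp[OF s(1) a] app_act[OF category_axioms N.endo[OF \<sigma>(1)] a gen_mem[OF I]] \<sigma>(2) by simp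
    then have "N.orbit x (act ?n a (gen I)) (act ?n (a \<cdot> s) (gen I))"
      using \<sigma>(1) unfolding N.orbit_def by blast
    then show ?thesis using orbit_cls[OF a cmp_hom[OF s(1) a]] by simp
  qed
  \<comment> \<open>A member of \<open>?G\<close> sends the generator to the action of some
    \<open>t\<close> on it, so arrows of equal class differ by precomposition with an
    endomorphism.\<close>
  have cls_eqD: "\<exists>t\<in>homset C I I. b = a \<cdot> t"
    if a: "a \<in> homset C I x" and b: "b \<in> homset C I x" and eq: "cls x a = cls x b" for x a b
  proof -
    obtain \<sigma> where \<sigma>: "\<sigma> \<in> ?G" "act ?n b (gen I) = app \<sigma> x (act ?n a (gen I))"
      using eq orbit_cls[OF a b] unfolding N.orbit_def by blast
    obtain t where t: "t \<in> homset C I I" "app \<sigma> I (gen I) = act ?n t (gen I)"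
      using can_elementE[OF I I app_mem[OF N.endo[OF \<sigma>(1)] I gen_mem[OF I]]] .
    have "act ?n b (gen I) = act ?n (a \<cdot> t) (gen I)"
      using can_act_cmp[OF t(1) a] app_act[OF category_axioms N.endo[OF \<sigma>(1)] a gen_mem[OF I]] \<sigma>(2) t(2)
      by simp
    then show ?thesis using can_act_eq_iff[OF b cmp_hom[OF t(1) a]] t(1) by blast
  qed
  \<comment> \<open>Whenever \<open>\<alpha>\<close> and \<open>\<beta>\<close> agree on
    \<open>f\<close>, the arrows \<open>\<alpha> \<cdot> i\<close> and
    \<open>\<beta> \<cdot> i\<close> differ by an automorphism of \<open>I\<close>, so their classes
    coincide.\<close>
  have "self_matching C N.quot f (cls B i)"
    unfolding self_matching_def B_def[symmetric]
  proof (intro conjI allI ballI impI)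
    fix X \<alpha> \<beta> assume \<alpha>: "\<alpha> \<in> homset C B X" and \<beta>: "\<beta> \<in> homset C B X" and eq: "\<alpha> \<cdot> f = \<beta> \<cdot> f"
    obtain s where s: "s \<in> homset C I I" "is_iso C s" "\<beta> \<cdot> i = (\<alpha> \<cdot> i) \<cdot> s"
      using self_intersection_automorphism[OF f i si largest \<alpha> \<beta> eq] .
    show "act N.quot \<alpha> (cls B i) = act N.quot \<beta> (cls B i)"
      using cls_act[OF i \<alpha>] cls_act[OF i \<beta>] cls_iso[OF cmp_hom[OF i \<alpha>] s(1,2)] s(3) by simp
  qed (rule cls_mem[OF i])
  then have "cls B i \<in> act N.quot f ` fob N.quot A"
    using sheafQ assms(2) unfolding sheaf_iff A_def by blast
  then obtain d where d: "d \<in> fob N.quot A" "cls B i = act N.quot f d" by blast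
  have A: "A \<in> obj C" using homset_obj(1)[OF f] .
  obtain e where e: "e \<in> fob ?n A" "d = app N.quot_map A e"
    using d(1) unfolding N.coequalizer_elementwise(2)[OF Q A] by blast
  \<comment> \<open>The descended element is the class of an arrow \<open>h\<close> from
    \<open>I\<close> to \<open>A\<close>; as \<open>f \<cdot> h\<close> and \<open>i\<close> have
    one class, \<open>i\<close> factors through \<open>f\<close>.\<close>
  obtain h where h: "h \<in> homset C I A" "e = act ?n h (gen I)" using can_elementE[OF I A e(1)] .
  have "cls B (f \<cdot> h) = cls B i" using cls_act[OF h(1) f] d(2) e(2) h(2) by (simp add: cls_def)
  then obtain t where t: "t \<in> homset C I I" "i = (f \<cdot> h) \<cdot> t"
    using cls_eqD[OF cmp_hom[OF h(1) f] i] by blast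
  have ht: "h \<cdot> t \<in> homset C I A" and fht: "i = f \<cdot> (h \<cdot> t)"
    using cmp_hom[OF t(1) h(1)] t(2) cmp_assoc[OF t(1) h(1) f] by simp_all
  show ?thesis
    unfolding definable_iff[OF assms(2)] A_def[symmetric] B_def[symmetric]
  proof (intro ballI impI)
    fix u assume "u \<in> arr C" "tgt C u = B" and su: "self_intersecting f u"
    then have u: "u \<in> homset C (src C u) B" by (simp add: homset_def)
    obtain w where w: "w \<in> homset C (src C u) I" "u = i \<cdot> w" using largest[OF u su] by blast
    have "u = f \<cdot> ((h \<cdot> t) \<cdot> w)" using w(2) fht cmp_assoc[OF w(1) ht f] by simp
    then show "\<exists>w\<in>homset C (src C u) A. u = f \<cdot> w" using cmp_hom[OF w(1) ht] by blast
  qed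
qed

end


theorem theorem2p6:
  fixes C :: "('o, 'a) cat"
    and \<iota> :: "'a \<Rightarrow> 's"
    and L :: "(('o, 'a, 's) setftor, ('o, 'a, 's) setnat,
               ('o, 'a, 's) setftor, ('o, 'a, 's) setnat) ftor"
    and \<eta> :: "('o, 'a, 's) setftor \<Rightarrow> ('o, 'a, 's) setnat"
  assumes "category C"
    and "infinite (UNIV :: 's set)" and "inj_on \<iota> (arr C)"
    and "is_sheafification (opcat C) (atomic_topology (opcat C)) L \<eta>"
    and C1: "fully_faithful (opcat C) (atomic_sheaf_cat (opcat C))
               (canonical_functor (opcat C) \<iota> L)"
            "\<forall>c\<in>obj (opcat C). is_atom (atomic_sheaf_cat (opcat C))
               (fob (canonical_functor (opcat C) \<iota> L) c)"
    and C2: "has_pushouts (opcat C)"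
            "preserves_pushouts (opcat C) (atomic_sheaf_cat (opcat C))
               (canonical_functor (opcat C) \<iota> L)"
    and C3: "well_founded C"
  shows
    "((\<forall>f\<in>arr C. definable_by_self_intersections C f) \<longleftrightarrow>
      (\<forall>n G Q q.
         is_representable_atom (opcat C) \<iota> L n \<and>
         subgroup G (aut_group (atomic_sheaf_cat (opcat C)) n) \<and>
         is_common_coequalizer (functor_cat C set_cat) n G Q q \<longrightarrow>
         is_sheaf (opcat C) (atomic_topology (opcat C)) Q))
     \<and>
     ((\<forall>f\<in>arr C. definable_by_self_intersections C f) \<longleftrightarrow>
      (\<forall>F :: ('o, 'a, 's) setftor.
         is_sheaf (opcat C) (atomic_topology (opcat C)) F \<longleftrightarrow>
         is_functor C set_cat F \<and> preserves_pullbacks C set_cat F))"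
proof -
  interpret atomic_setting C \<iota> L \<eta>
    using assms by (intro atomic_setting.intro atomic_setting_axioms.intro)
  let ?one = "\<forall>f\<in>arr C. definable_by_self_intersections C f"
  let ?two = "\<forall>n G Q q.
         is_representable_atom (opcat C) \<iota> L n \<and> subgroup G (aut_group Sh n) \<and>
         is_common_coequalizer Psh n G Q q \<longrightarrow> sheaf Q"
  let ?three = "\<forall>F :: ('o, 'a, 's) setftor.
         sheaf F \<longleftrightarrow> is_functor C set_cat F \<and> preserves_pullbacks C set_cat F"
  have "?one \<Longrightarrow> ?three"
    using sheaf_if_preserves_pullbacks sheaf_functor sheaf_preserves_pullbacks by blast
  moreover have "?three \<Longrightarrow> ?two"
  proof (intro allI impI, elim conjE)
    fix n G Q q
    assume three: ?three and n: "is_representable_atom (opcat C) \<iota> L n"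
      and G: "subgroup G (aut_group Sh n)" and Q: "is_common_coequalizer Psh n G Q q"
    obtain c where "c \<in> obj C" "n = fob can c" using n by (auto simp: is_representable_atom_def)
    \<comment> \<open>\<open>quotient_preserves_pullbacks\<close> places \<open>Q\<close> among the
      pullback-preserving functors, which are sheaves by \<open>?three\<close>.\<close>
    then show "sheaf Q" using three quotient_preserves_pullbacks[of c G Q q] G Q by blast
  qed
  moreover have "?two \<Longrightarrow> ?one" using definable_if_quotients_sheaves by blast
  \<comment> \<open>The implications form a cycle through (1), (3), (2) and back to (1), which gives
    both equivalences.\<close>
  ultimately show ?thesis by argo
qed

end
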